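(* Let $\kappa\in\overline{\mathbb Q}\setminus\mu_\infty$ be an algebraic number in $\mathbb C$ lying on the unit circle (i.e. $|\kappa|=1$), and let $d=[\mathbb Q(\kappa):\mathbb Q]$. Then there exists a strict sequence $(\alpha_n)_{n\in\mathbb N}$ of algebraic numbers such that no $\alpha_n$ is a conjugate of $\kappa$, $\lim_{n\to\infty}h(\alpha_n)=0$, $$\limsup_{n\to\infty}\frac{1}{[\mathbb Q(\alpha_n):\mathbb Q]}\sum_{\sigma:\mathbb Q(\alpha_n)\to\mathbb C}\log|\sigma(\alpha_n)-\kappa|\le -h(\kappa)<0,$$ and $$\liminf_{n\to\infty}\frac{1}{[\mathbb Q(\alpha_n):\mathbb Q]}\sum_{\sigma:\mathbb Q(\alpha_n)\to\mathbb C}\log|\sigma(\alpha_n)-\kappa|\ge -d\,(h(\kappa)+\log 2).$$ Here the sums run over all field embeddings $\sigma:\mathbb Q(\alpha_n)\to\mathbb C$.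
   Context: $\overline{\mathbb Q}$ is the set of algebraic numbers in $\mathbb C$, $|\cdot|$ is the complex absolute value, and $\mu_\infty\subseteq\overline{\mathbb Q}$ is the set of all roots of unity. For $P\in\mathbb Z[X]\setminus\{0\}$ the logarithmic Mahler measure is $m(P)=\int_0^1\log|P(e^{2\pi i t})|\,dt$. For $\alpha\in\overline{\mathbb Q}$, the $\mathbb Z$-minimal polynomial of $\alpha$ is the unique irreducible $P=a_DX^D+\dots+a_0\in\mathbb Z[X]$ with $P(\alpha)=0$ and $a_D\ge1$; the absolute logarithmic Weil height is $h(\alpha)=m(P)/D$. A sequence $(\alpha_n)_{n\in\mathbb N}$ of algebraic numbers is called strict if for every $\alpha\in\overline{\mathbb Q}$ there are at most finitely many $n$ with $\alpha_n=\alpha$. Two algebraic numbers are conjugate if they have the same minimal polynomial over $\mathbb Q$. *)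

theory Defs
  imports "HOL-Analysis.Analysis" "HOL-Computational_Algebra.Computational_Algebra"
begin

definition roots_of_unity :: "complex set" where
  "roots_of_unity = {z. \<exists>n>0. z ^ n = 1}"

definition log_mahler :: "int poly \<Rightarrow> real" where
  "log_mahler P = integral {0..1} (\<lambda>t. ln (cmod (poly (map_poly of_int P) (cis (2 * pi * t)))))"

text \<open>Irreducibility in \<open>\<int>[X]\<close> forces the polynomial to be primitive.  As with every
  \<open>THE\<close> below, the value is meaningful for algebraic arguments only.\<close>

definition int_min_poly :: "complex \<Rightarrow> int poly" where
  "int_min_poly \<alpha> =
     (THE P. irreducible P \<and> poly (map_poly of_int P) \<alpha> = 0 \<and> lead_coeff P \<ge> 1)"

definition weil_height :: "complex \<Rightarrow> real" where
  "weil_height \<alpha> = log_mahler (int_min_poly \<alpha>) / real (degree (int_min_poly \<alpha>))"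

definition rat_min_poly :: "complex \<Rightarrow> rat poly" where
  "rat_min_poly \<alpha> =
     (THE p. irreducible p \<and> poly (map_poly of_rat p) \<alpha> = 0 \<and> lead_coeff p = 1)"

definition conjugate :: "complex \<Rightarrow> complex \<Rightarrow> bool" where
  "conjugate \<alpha> \<beta> \<longleftrightarrow> rat_min_poly \<alpha> = rat_min_poly \<beta>"

definition complex_subfield :: "complex set \<Rightarrow> bool" where
  "complex_subfield K \<longleftrightarrow> 0 \<in> K \<and> 1 \<in> K \<and>
     (\<forall>x\<in>K. \<forall>y\<in>K. x + y \<in> K \<and> x * y \<in> K) \<and> (\<forall>x\<in>K. - x \<in> K \<and> inverse x \<in> K)"

definition rat_adjoin :: "complex \<Rightarrow> complex set" where
  "rat_adjoin \<alpha> = \<Inter>{K. complex_subfield K \<and> \<alpha> \<in> K}"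

lemma vector_space_rat_complex: "vector_space (\<lambda>(q::rat) (z::complex). of_rat q * z)"
  by unfold_locales (simp_all add: algebra_simps of_rat_add of_rat_mult)

text \<open>\<open>[\<rat>(\<alpha>) : \<rat>]\<close>, as the dimension of \<open>\<rat>(\<alpha>)\<close> over the rationals
  (\<open>0\<close> if the dimension is infinite, that is, if \<open>\<alpha>\<close> is transcendental).\<close>

definition rat_degree :: "complex \<Rightarrow> nat" where
  "rat_degree \<alpha> = vector_space.dim (\<lambda>(q::rat) (z::complex). of_rat q * z) (rat_adjoin \<alpha>)"

text \<open>Functions on \<open>\<rat>(\<alpha>)\<close> are represented by their extensional versions, so that each
  embedding is counted exactly once.  Injectivity is automatic since \<open>\<sigma> 1 = 1\<close>.\<close>

definition field_embeddings :: "complex \<Rightarrow> (complex \<Rightarrow> complex) set" where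
  "field_embeddings \<alpha> = {\<sigma> \<in> extensional (rat_adjoin \<alpha>). \<sigma> 1 = 1 \<and>
     (\<forall>x\<in>rat_adjoin \<alpha>. \<forall>y\<in>rat_adjoin \<alpha>. \<sigma> (x + y) = \<sigma> x + \<sigma> y \<and> \<sigma> (x * y) = \<sigma> x * \<sigma> y)}"

definition mean_log_dist :: "complex \<Rightarrow> complex \<Rightarrow> real" where
  "mean_log_dist \<kappa> \<alpha> =
     1 / real (rat_degree \<alpha>) * (\<Sum>\<sigma>\<in>field_embeddings \<alpha>. ln (cmod (\<sigma> \<alpha> - \<kappa>)))"

definition strict_sequence :: "(nat \<Rightarrow> complex) \<Rightarrow> bool" where
  "strict_sequence \<alpha> \<longleftrightarrow> (\<forall>\<beta>. algebraic \<beta> \<longrightarrow> finite {n. \<alpha> n = \<beta>})"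

end

theory Submission
  imports Defs
    "HOL-Complex_Analysis.Complex_Analysis"
    "HOL-Computational_Algebra.Field_as_Ring"
    "HOL-Number_Theory.Cong"
    "HOL-Real_Asymp.Real_Asymp"
    "Subresultants.Subresultant_Gcd"
begin

hide_const (open) Conjugate.conjugate Module.smult

text \<open>
  Let \<open>f\<close> be the \<open>\<int>\<close>-minimal polynomial of \<open>\<kappa>\<close>, \<open>d\<close> its degree and
  \<open>m(f) = d h(\<kappa>)\<close> its logarithmic Mahler measure.
  If \<open>A\<close> is irreducible in \<open>\<int>[X]\<close> with root \<open>\<alpha>\<close>, the mean over the embeddings is
  \<open>(log |A(\<kappa>)| - log lc(A)) / deg A\<close>.  So the task is to find irreducible \<open>A\<close> of growing degree
  with \<open>m(A) = o(deg A)\<close> and \<open>|A(\<kappa>)|\<close> nonzero but as small as \<open>exp(-h(\<kappa>) deg A)\<close>.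

  A small value comes from the pigeonhole principle, but a polynomial found in that way may vanish
  at \<open>\<kappa>\<close>.  The remedy is to make the first \<open>T\<close> Taylor coefficients at \<open>\<kappa>\<close> small at the same
  time.  For degree \<open>D = n^3\<close> and coefficients up to \<open>2^n\<close> the Mahler measure of \<open>P\<close> is at most
  \<open>n log 2 + log (D + 1)\<close>, so \<open>f^T\<close> cannot divide \<open>P\<close> as soon as \<open>T m(f)\<close> exceeds this.
  Hence \<open>P = f^j Q\<close> with \<open>j < T\<close> and \<open>Q(\<kappa>) \<noteq> 0\<close>, and the \<open>j\<close>-th Taylor coefficient of \<open>P\<close> is
  \<open>f'(\<kappa>)^j Q(\<kappa>)\<close>.  There are \<open>2^(n(D+1))\<close> polynomials and \<open>2T\<close> real conditions, which
  gives \<open>log |Q(\<kappa>)| \<le> -(n D log 2)/(2T) + o(D) = -(m(f)/2) D + o(D)\<close>.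
  Since \<open>\<kappa>\<close> is not a root of unity it is not real, so \<open>d \<ge> 2\<close> and \<open>m(f)/2 \<ge> h(\<kappa>)\<close>
  (\<open>exists_small_value\<close>).

  The factors of \<open>Q\<close> could still have small degree; for instance all of them could be cyclotomic
  polynomials from a fixed finite list, and the resulting sequence would not be strict.
  Therefore \<open>Q\<close> is replaced by \<open>f S + p Q\<close>, which takes the value \<open>p Q(\<kappa>)\<close> at \<open>\<kappa>\<close>, where
  \<open>S\<close> is \<open>f^(K-1)\<close> with coefficients reduced modulo a prime \<open>p\<close> and \<open>K d\<close> is slightly larger than
  \<open>D\<close>.  This polynomial is congruent to \<open>f^K\<close> modulo \<open>p\<close>, and if \<open>p\<close> divides neither the leading
  coefficient of \<open>f\<close> nor the resultant of \<open>f\<close> and \<open>Q\<close>, an argument in the style of Eisenstein and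
  Schoenemann shows that each of its nonconstant factors has degree at least \<open>K\<close>
  (\<open>degree_factor_ge_exponent\<close>).  The prime must be of size \<open>exp(o(D))\<close>.  This is possible because
  the resultant contains the two tiny factors \<open>Q(\<kappa>)\<close> and \<open>Q(cnj \<kappa>)\<close>, which together cancel the
  factor \<open>exp(D m(f))\<close> of the trivial bound, so the resultant itself is \<open>exp(o(D))\<close>.
  All coefficients are \<open>exp(o(D))\<close>, so the Mahler measure of every factor is \<open>o(D)\<close>, hence \<open>o(deg A)\<close>;
  and for one of the irreducible factors the mean is at most that of the whole polynomial.

  The lower bound holds for every sequence of non-conjugates of \<open>\<kappa>\<close> with heights tending to \<open>0\<close>: the resultant of \<open>f\<close>
  and \<open>A\<close> is a nonzero integer (\<open>liouville\<close>).  The same inequality applied to \<open>X^n - 1\<close>, with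
  \<open>\<kappa>^n\<close> close to \<open>1\<close>, gives \<open>h(\<kappa>) > 0\<close>.
\<close>

section \<open>Resultants as norms\<close>

abbreviation cpoly :: "int poly \<Rightarrow> complex poly" where
  "cpoly P \<equiv> map_poly of_int P"

text \<open>The product formula for the resultant.  With the determinantal definition it becomes
  available for polynomials over \<open>\<int>\<close>: the product over the complex roots is an integer, and it respects
  congruences.\<close>

definition root_resultant :: "complex poly \<Rightarrow> complex poly \<Rightarrow> complex" where
  "root_resultant F G = lead_coeff F ^ degree G * (\<Prod>x\<in>#proots F. poly G x)"

lemma poly_eq_prod_roots:
  "poly F z = lead_coeff F * (\<Prod>x\<in>#proots F. (z - x))" for F :: "complex poly"
proof -
  have "poly F z = poly (smult (lead_coeff F) (\<Prod>x\<in>#proots F. [:- x, 1:])) z"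
    by (simp only: complex_poly_decompose_multiset)
  also have "\<dots> = lead_coeff F * poly (\<Prod>x\<in>#proots F. [:- x, 1:]) z" by simp
  also have "poly (\<Prod>x\<in>#M. [:- x, 1:]) z = (\<Prod>x\<in>#M. (z - x))" for M :: "complex multiset"
    by (induction M) (auto simp: algebra_simps)
  finally show ?thesis by simp
qed

lemma prod_mset_mult_const: "(\<Prod>x\<in>#M. (c::'a::comm_monoid_mult) * f x) = c ^ size M * (\<Prod>x\<in>#M. f x)"
  by (induction M) (auto simp: algebra_simps)

lemma prod_mset_power: "(\<Prod>x\<in>#M. f x ^ n) = (\<Prod>x\<in>#M. f x :: 'a :: comm_monoid_mult) ^ n"
  by (induction M) (auto simp: algebra_simps power_mult_distrib)

lemma prod_mset_poly:
  "(\<Prod>x\<in>#M. poly G x) = lead_coeff G ^ size M * (\<Prod>x\<in>#M. \<Prod>y\<in>#proots G. (x - y))"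
  for G :: "complex poly"
  unfolding prod_mset_mult_const[symmetric] poly_eq_prod_roots[of G, symmetric] ..

lemma prod_mset_poly_const: "(\<Prod>x\<in>#M. poly [:c:] x) = c ^ size M" for c :: "'a::comm_ring_1"
  by (induction M) auto

lemma prod_mset_swap: "(\<Prod>x\<in>#M. \<Prod>y\<in>#N. f x y) = (\<Prod>y\<in>#N. \<Prod>x\<in>#M. (f x y :: 'a :: comm_monoid_mult))"
  by (induction M) (auto simp: prod_mset.distrib)

lemma root_resultant_swap:
  assumes "F \<noteq> 0" "G \<noteq> 0"
  shows "root_resultant F G = (-1) ^ (degree F * degree G) * root_resultant G F"
proof -
  have "root_resultant F G = lead_coeff F ^ degree G * lead_coeff G ^ degree F *
      (\<Prod>x\<in>#proots F. \<Prod>y\<in>#proots G. (x - y))"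
    unfolding root_resultant_def
    by (simp add: prod_mset_poly[of G] size_proots_complex)
  also have "(\<Prod>x\<in>#proots F. \<Prod>y\<in>#proots G. (x - y)) =
     (\<Prod>x\<in>#proots F. \<Prod>y\<in>#proots G. (-1) * (y - x))" by simp
  also have "\<dots> = (-1) ^ (degree F * degree G) * (\<Prod>x\<in>#proots F. \<Prod>y\<in>#proots G. (y - x))"
    by (simp only: prod_mset_mult_const size_proots_complex power_mult[symmetric] mult.commute[of "degree G"])
  also have "(\<Prod>x\<in>#proots F. \<Prod>y\<in>#proots G. (y - x)) = (\<Prod>y\<in>#proots G. \<Prod>x\<in>#proots F. (y - x))"
    by (rule prod_mset_swap)
  also have "lead_coeff F ^ degree G * lead_coeff G ^ degree F * ((- 1) ^ (degree F * degree G) *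
      (\<Prod>y\<in>#proots G. \<Prod>x\<in>#proots F. (y - x))) = (-1) ^ (degree F * degree G) * root_resultant G F"
    unfolding root_resultant_def
    by (simp add: prod_mset_poly[of F] size_proots_complex)
  finally show ?thesis .
qed

text \<open>Both sides change in the same way under a division \<open>F + B G = H\<close> with remainder: the
  determinant by the identities of Brown and Traub for subresultants, the product because \<open>F\<close> and \<open>H\<close>
  agree at the roots of \<open>G\<close>.  Induction over the Euclidean algorithm reduces to constant polynomials.\<close>

lemma resultant_eq_root_resultant_aux:
  assumes "F \<noteq> 0" "G \<noteq> 0" "degree G \<le> degree F"
  shows "resultant F G = root_resultant F G"
  using assms
proof (induction "degree G" arbitrary: F G rule: less_induct)
  case less
  show ?case
  proof (cases "degree G = 0")
    case True
    then obtain c where "G = [:c:]" by (rule degree_eq_zeroE)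
    then show ?thesis
      by (simp only: root_resultant_def prod_mset_poly_const size_proots_complex resultant_const) simp
  next
    case False
    define H where "H = F mod G"
    have eq: "F + (- (F div G)) * G = H"
      unfolding H_def by (metis add_uminus_conv_diff minus_mult_div_eq_mod mult.commute mult_minus_left)
    have FH: "poly F y = poly H y" if "y \<in># proots G" for y
    proof -
      have "poly G y = 0" using that less.prems by simp
      then show ?thesis using arg_cong[OF eq, of "\<lambda>p. poly p y"] by simp
    qed
    have dH: "degree H < degree G" if "H \<noteq> 0"
      using that degree_mod_less[of G F] less.prems(2) unfolding H_def by auto
    have dH': "degree H < degree G \<or> H = 0 \<and> F \<noteq> 0 \<and> G \<noteq> 0" using dH less.prems by auto
    have dHG: "degree H < degree G" using dH False by (cases "H = 0") auto
    have imgs: "image_mset (poly F) (proots G) = image_mset (poly H) (proots G)"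
      by (intro image_mset_cong FH)
    have swap: "root_resultant F G = (-1) ^ (degree F * degree G) *
       (lead_coeff G ^ degree F * (\<Prod>y\<in>#proots G. poly H y))"
      unfolding root_resultant_swap[OF less.prems(1,2)] root_resultant_def[of G]
      using arg_cong[OF imgs, of prod_mset] by simp
    show ?thesis
    proof (cases "degree H = 0")
      case True
      then obtain c where c: "H = [:c:]" by (rule degree_eq_zeroE)
      have "[:resultant F G:] = subresultant 0 F G" by (rule subresultant_resultant[symmetric])
      also have "\<dots> = smult ((- 1) ^ (degree F * degree G) * lead_coeff G ^ degree F * lead_coeff H ^ (degree G - 1)) H"
        using BT_lemma_1_13'[OF eq less.prems(3) dH', of 0] True False by simp
      finally have "resultant F G = (- 1) ^ (degree F * degree G) * lead_coeff G ^ degree F * (c ^ (degree G - 1) * c)"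
        unfolding c by simp
      also have "c ^ (degree G - 1) * c = c ^ degree G" using False by (cases "degree G") auto
      finally show ?thesis unfolding swap c by (simp only: prod_mset_poly_const size_proots_complex mult.assoc)
    next
      case dH0: False
      then have H0: "H \<noteq> 0" by auto
      have "[:resultant F G:] = subresultant 0 F G" by (rule subresultant_resultant[symmetric])
      also have "\<dots> = smult ((- 1) ^ (degree F * degree G) * lead_coeff G ^ (degree F - degree H)) (subresultant 0 G H)"
        using BT_lemma_1_12[OF eq less.prems(3) dH', of 0] dH0 by simp
      also have "subresultant 0 G H = [:resultant G H:]" by (rule subresultant_resultant)
      also have "resultant G H = root_resultant G H"
        using less.hyps[OF dHG less.prems(2) H0] dHG by simp
      finally have "resultant F G = (- 1) ^ (degree F * degree G) * lead_coeff G ^ (degree F - degree H) * root_resultant G H"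
        by simp
      also have "\<dots> = (- 1) ^ (degree F * degree G) * (lead_coeff G ^ (degree F - degree H + degree H) * (\<Prod>y\<in>#proots G. poly H y))"
        unfolding root_resultant_def power_add by (simp add: mult_ac)
      also have "degree F - degree H + degree H = degree F" using dHG less.prems(3) by simp
      finally show ?thesis unfolding swap .
    qed
  qed
qed

lemma resultant_eq_root_resultant:
  assumes "F \<noteq> 0" "G \<noteq> 0"
  shows "resultant F G = root_resultant F G"
proof (cases "degree G \<le> degree F")
  case True
  then show ?thesis using resultant_eq_root_resultant_aux assms by blast
next
  case False
  then show ?thesis using resultant_eq_root_resultant_aux[of G F] assms
    root_resultant_swap[of F G] resultant_swap[of F G] by (simp add: mult.commute)
qed

lemma of_int_resultant:
  fixes F G :: "int poly"
  assumes "F \<noteq> 0" "G \<noteq> 0"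
  shows "of_int (resultant F G) = of_int (lead_coeff F) ^ degree G * (\<Prod>x\<in>#proots (cpoly F). poly (cpoly G) x)"
proof -
  have "of_int (resultant F G) = resultant (cpoly F) (cpoly G)"
    by (rule of_int_hom.resultant_map_poly[symmetric]) auto
  also have "\<dots> = root_resultant (cpoly F) (cpoly G)"
    using assms by (intro resultant_eq_root_resultant) auto
  finally show ?thesis by (simp add: root_resultant_def)
qed

lemma resultant_mult_right:
  fixes F G H :: "int poly"
  assumes "F \<noteq> 0" "G \<noteq> 0" "H \<noteq> 0"
  shows "resultant F (G * H) = resultant F G * resultant F H"
proof -
  have "complex_of_int (resultant F (G * H)) = of_int (resultant F G * resultant F H)"
    using assms by (simp add: of_int_resultant of_int_poly_hom.hom_mult degree_mult_eq power_add prod_mset.distrib)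
  then show ?thesis by (simp only: of_int_eq_iff)
qed

lemma resultant_power_right:
  fixes F G :: "int poly"
  assumes "F \<noteq> 0" "G \<noteq> 0"
  shows "resultant F (G ^ n) = resultant F G ^ n"
  using assms by (induction n) (auto simp: resultant_mult_right)

text \<open>Equal degrees give Sylvester matrices of the same shape, whose entries are then
  congruent.  If the degree dropped, the two resultants would differ by a power of the leading coefficient
  of \<open>F\<close>.\<close>

lemma resultant_cong_right:
  fixes F G H :: "int poly"
  assumes "\<And>i. [coeff G i = coeff H i] (mod p)" "degree G = degree H"
  shows "[resultant F G = resultant F H] (mod p)"
proof -
  let ?n = "degree F + degree H"
  have dim: "sylvester_mat F G \<in> carrier_mat ?n ?n" "sylvester_mat F H \<in> carrier_mat ?n ?n"
    using assms(2) by (auto simp: sylvester_carrier_mat simp flip: assms(2))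
  have "[sylvester_mat F G $$ (i, j) = sylvester_mat F H $$ (i, j)] (mod p)" if "i < ?n" "j < ?n" for i j
    using that assms by (auto simp: sylvester_index_mat cong_refl)
  then show ?thesis
    unfolding resultant_def det_def'[OF dim(1)] det_def'[OF dim(2)]
    by (intro cong_sum cong_mult cong_refl cong_prod) (auto simp: permutes_def dest!: permutes_in_image)
qed

lemma proots_cpoly_root: "x \<in># proots (cpoly F) \<Longrightarrow> poly (cpoly F) x = 0"
  by (metis count_eq_zero_iff count_proots order_root proots_0 set_mset_empty empty_iff)

lemma cpoly_mult: "cpoly (P * Q) = cpoly P * cpoly Q"
  by (rule of_int_poly_hom.hom_mult)

lemma cpoly_add: "cpoly (P + Q) = cpoly P + cpoly Q"
  by (rule of_int_poly_hom.hom_add)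

lemma cpoly_power: "cpoly (P ^ n) = cpoly P ^ n"
  by (rule of_int_poly_hom.hom_power)

lemma cpoly_smult: "cpoly (smult c P) = smult (of_int c) (cpoly P)"
  by (rule of_int_hom.map_poly_hom_smult)

lemmas cpoly_simps = cpoly_mult cpoly_add cpoly_power cpoly_smult

lemma resultant_eq_0_if_dvd:
  fixes F G :: "int poly"
  assumes "F \<noteq> 0" "G \<noteq> 0" "degree F > 0" "F dvd G"
  shows "resultant F G = 0"
proof -
  obtain H where H: "G = F * H" using assms by auto
  obtain z where z: "z \<in># proots (cpoly F)"
  proof -
    have "size (proots (cpoly F)) = degree F" by (simp add: size_proots_complex)
    then show ?thesis using assms(3) that by (cases "proots (cpoly F)") auto
  qed
  have "poly (cpoly G) z = 0" using proots_cpoly_root[OF z] by (simp add: H cpoly_simps)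
  then have "(\<Prod>x\<in>#proots (cpoly F). poly (cpoly G) x) = 0"
    using z by (auto simp: prod_mset_zero_iff)
  then have "complex_of_int (resultant F G) = 0"
    using of_int_resultant[OF assms(1,2)] by simp
  then show ?thesis by simp
qed

section \<open>Jensen's formula and the Mahler measure\<close>

text \<open>The mean value property of the harmonic function \<open>log |1 - a z|\<close>, the real part of a function that is
  holomorphic on the closed unit disc.\<close>

lemma jensen_inside:
  assumes "cmod a < 1"
  shows "((\<lambda>t. ln (cmod (1 - a * cis (2 * pi * t)))) has_integral 0) {0..1}"
proof -
  have pos: "1 - a * z \<notin> \<real>\<^sub>\<le>\<^sub>0" if "cmod z \<le> 1" for z
  proof
    assume "1 - a * z \<in> \<real>\<^sub>\<le>\<^sub>0"
    then have "Re (a * z) \<ge> 1" by (simp add: complex_nonpos_Reals_iff)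
    then have "1 \<le> cmod (a * z)" using complex_Re_le_cmod order_trans by blast
    also have "\<dots> \<le> cmod a * 1" unfolding norm_mult using that by (intro mult_left_mono) auto
    finally show False using assms by simp
  qed
  define g where "g = (\<lambda>z. Ln (1 - a * z))"
  have "g holomorphic_on cball 0 1" unfolding g_def
    by (intro holomorphic_intros) (use pos in auto)
  then have "((\<lambda>u. g u / (u - 0)) has_contour_integral 2 * of_real pi * \<i> * g 0) (circlepath 0 1)"
    by (intro Cauchy_integral_circlepath_simple) auto
  then have "((\<lambda>u. g u / u) has_contour_integral 0) (circlepath 0 1)"
    by (simp add: g_def)
  moreover have "exp (2 * of_real pi * \<i> * of_real x) = cis (2 * pi * x)" for x
    by (simp add: cis_conv_exp mult_ac)
  ultimately have "((\<lambda>x. 2 * pi * \<i> * g (cis (2 * pi * x))) has_integral 0) {0..1}"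
    unfolding has_contour_integral vector_derivative_circlepath by (simp add: circlepath mult_ac)
  from has_integral_mult_right[OF this, of "1 / (2 * pi * \<i>)"]
  have "((\<lambda>x. g (cis (2 * pi * x))) has_integral 0) {0..1}"
    by simp
  from has_integral_linear[OF this bounded_linear_Re]
  have "((\<lambda>x. Re (g (cis (2 * pi * x)))) has_integral 0) {0..1}"
    by (simp add: o_def)
  moreover have "Re (g (cis (2 * pi * x))) = ln (cmod (1 - a * cis (2 * pi * x)))" for x
    unfolding g_def using pos[of "cis (2 * pi * x)"] by (subst Re_Ln) auto
  ultimately show ?thesis by simp
qed

lemma finite_cis_eq: "finite {t \<in> {0..1::real}. cis (2 * pi * t) = a}"
proof (cases "\<exists>s. cis (2 * pi * s) = a \<and> s \<in> {0..1}")
  case True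
  then obtain s where s: "cis (2 * pi * s) = a" "s \<in> {0..1}" by auto
  have "t \<in> {s - 1, s, s + 1}" if "t \<in> {0..1}" "cis (2 * pi * t) = a" for t
  proof -
    have "cis (2 * pi * t - 2 * pi * s) = 1" using that s
      by (metis cis_divide cis_neq_zero divide_self)
    then have "exp (\<i> * of_real (2 * pi * t - 2 * pi * s)) = 1" by (simp only: cis_conv_exp)
    then obtain n :: int where "2 * pi * t - 2 * pi * s = of_int (2 * n) * pi"
      by (auto simp: exp_eq_1)
    then have "2 * pi * (t - s) = 2 * pi * of_int n" by (simp add: algebra_simps)
    then have n: "t = s + of_int n" by simp
    then have "\<bar>real_of_int n\<bar> \<le> 1" using that(1) s(2) by auto
    then have "\<bar>n\<bar> \<le> 1" by linarith
    then have "n \<in> {-1, 0, 1}" by auto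
    then show ?thesis using n by auto
  qed
  then have "{t \<in> {0..1}. cis (2 * pi * t) = a} \<subseteq> {s - 1, s, s + 1}" by auto
  then show ?thesis by (rule finite_subset) auto
next
  case False
  then have "{t \<in> {0..1::real}. cis (2 * pi * t) = a} = {}" by auto
  then show ?thesis by (metis finite.emptyI)
qed

lemma cmod_cis_minus: "cmod (cis x - a) = cmod (1 - cnj a * cis x)"
proof -
  have "cmod (cis x - a) = cmod (cis x * (1 - a * cnj (cis x)))"
    using complex_norm_square[of "cis x"] by (simp add: right_diff_distrib mult.left_commute[of _ a])
  also have "\<dots> = cmod (cnj (1 - a * cnj (cis x)))" unfolding complex_mod_cnj by (simp add: norm_mult)
  finally show ?thesis by simp
qed

text \<open>For \<open>a\<close> on the circle the integrand is unbounded, and the value is the limit of the integrals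
  for \<open>r a\<close> with \<open>r\<close> increasing to \<open>1\<close>.  These integrands are not monotone in \<open>r\<close>, but
  \<open>|w - r a|^2 / r = r + 1/r - 2 Re (w cnj a)\<close> decreases, so that subtracting \<open>(ln r) / 2\<close> makes
  monotone convergence applicable.\<close>

lemma jensen_unit_circle:
  assumes "cmod a = 1"
  shows "((\<lambda>t. ln (cmod (cis (2 * pi * t) - a))) has_integral 0) {0..1}"
proof -
  define B where "B = {t \<in> {0..1::real}. cis (2 * pi * t) = a}"
  define S where "S = {0..1} - B"
  have finB: "finite B" unfolding B_def by (rule finite_cis_eq)
  define r where "r = (\<lambda>k::nat. 1 - 1 / (real k + 2))"
  have r: "0 < r k" "r k < 1" "r k \<le> r (Suc k)" for k by (auto simp: r_def field_simps)
  have rlim: "r \<longlonglongrightarrow> 1" unfolding r_def by real_asymp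
  define u where "u = (\<lambda>k t. ln (cmod (cis (2 * pi * t) - of_real (r k) * a)) - ln (r k) / 2)"
  have spike: "(h has_integral y) S \<longleftrightarrow> (h has_integral y) {0..1}" for h :: "real \<Rightarrow> real" and y
  proof (rule has_integral_spike_set_eq)
    have "{x \<in> S - {0..1}. h x \<noteq> 0} = {}" by (auto simp: S_def)
    then show "negligible {x \<in> S - {0..1}. h x \<noteq> 0}" by (metis negligible_empty)
    have "{x \<in> {0..1} - S. h x \<noteq> 0} \<subseteq> B" by (auto simp: S_def)
    then show "negligible {x \<in> {0..1} - S. h x \<noteq> 0}"
      using finB by (meson negligible_finite negligible_subset)
  qed
  have uint: "(u k has_integral (- ln (r k) / 2)) S" for k
  proof -
    have "cmod (of_real (r k) * cnj a) < 1" using r[of k] assms by (simp add: norm_mult)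
    from jensen_inside[OF this]
    have "((\<lambda>t. ln (cmod (cis (2 * pi * t) - of_real (r k) * a))) has_integral 0) {0..1}"
      by (simp add: cmod_cis_minus)
    from has_integral_diff[OF this has_integral_const_real[of "ln (r k) / 2" 0 1]]
    show ?thesis unfolding spike by (simp add: u_def)
  qed
  have mono: "u (Suc k) t \<le> u k t" for k t
  proof -
    define w where "w = cis (2 * pi * t)"
    define c where "c = Re (w * cnj a)"
    have ww: "Re w * Re w + Im w * Im w = 1" "Re a * Re a + Im a * Im a = 1"
      using assms by (auto simp: w_def cmod_def simp flip: power2_eq_square)
    have sq: "(cmod (w - of_real s * a))\<^sup>2 = 1 + s\<^sup>2 - 2 * s * c" for s
    proof -
      have "(cmod (w - of_real s * a))\<^sup>2 = (Re w * Re w + Im w * Im w) + s\<^sup>2 * (Re a * Re a + Im a * Im a) - 2 * s * c"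
        unfolding cmod_power2 unfolding c_def power2_eq_square by (simp add: algebra_simps)
      then show ?thesis using ww by simp
    qed
    have nz: "cmod (w - of_real (r k) * a) > 0" for k
    proof -
      have "w \<noteq> of_real (r k) * a"
      proof
        assume "w = of_real (r k) * a"
        then have "cmod w = r k * cmod a" using r(1)[of k] by (simp add: norm_mult)
        then show False using assms r(2)[of k] by (simp add: w_def)
      qed
      then show ?thesis by simp
    qed
    have u2: "2 * u k t = ln ((cmod (w - of_real (r k) * a))\<^sup>2 / r k)" for k
      using nz[of k] r(1)[of k] by (simp add: u_def w_def ln_div ln_realpow)
    have "(cmod (w - of_real (r (Suc k)) * a))\<^sup>2 / r (Suc k) \<le> (cmod (w - of_real (r k) * a))\<^sup>2 / r k"
    proof -
      have "(1 - r k * r (Suc k)) * (r (Suc k) - r k) \<ge> 0"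
        using r[of k] r[of "Suc k"] by (intro mult_nonneg_nonneg) (auto intro: mult_le_one)
      then show ?thesis unfolding sq using r(1)[of k] r(1)[of "Suc k"]
        by (simp add: field_simps power2_eq_square)
    qed
    moreover have "0 < (cmod (w - of_real (r (Suc k)) * a))\<^sup>2 / r (Suc k)"
      using nz[of "Suc k"] r(1)[of "Suc k"] by simp
    ultimately have "2 * u (Suc k) t \<le> 2 * u k t" unfolding u2 by (rule ln_mono)
    then show ?thesis by simp
  qed
  have lim: "(\<lambda>k. u k t) \<longlonglongrightarrow> ln (cmod (cis (2 * pi * t) - a))" if "t \<in> S" for t
  proof -
    have "cmod (cis (2 * pi * t) - of_real 1 * a) \<noteq> 0" using that by (auto simp: S_def B_def)
    then have "(\<lambda>k. u k t) \<longlonglongrightarrow> ln (cmod (cis (2 * pi * t) - of_real 1 * a)) - ln 1 / 2"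
      unfolding u_def by (intro tendsto_intros rlim) auto
    then show ?thesis by simp
  qed
  have intu: "integral S (u k) = - ln (r k) / 2" for k using uint by (rule integral_unique)
  have "(\<lambda>k. - ln (r k) / 2) \<longlonglongrightarrow> - ln 1 / 2" by (intro tendsto_intros rlim) auto
  then have lim0: "(\<lambda>k. integral S (u k)) \<longlonglongrightarrow> 0" by (simp add: intu)
  have "(\<lambda>t. ln (cmod (cis (2 * pi * t) - a))) integrable_on S \<and>
     (\<lambda>k. integral S (u k)) \<longlonglongrightarrow> integral S (\<lambda>t. ln (cmod (cis (2 * pi * t) - a)))"
  proof (rule monotone_convergence_decreasing)
    show "u k integrable_on S" for k using uint by blast
    show "bounded (range (\<lambda>k. integral S (u k)))"
      using lim0 by (intro convergent_imp_bounded)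
  qed (use mono lim in auto)
  then have "((\<lambda>t. ln (cmod (cis (2 * pi * t) - a))) has_integral 0) S"
    using LIMSEQ_unique[OF lim0] by (metis integrable_integral)
  then show ?thesis unfolding spike .
qed

lemma jensen_linear:
  "((\<lambda>t. ln (cmod (cis (2 * pi * t) - a))) has_integral ln (max 1 (cmod a))) {0..1}"
proof -
  consider "cmod a < 1" | "cmod a = 1" | "cmod a > 1" by linarith
  then show ?thesis
  proof cases
    case 1
    then show ?thesis using jensen_inside[of "cnj a"] by (simp add: cmod_cis_minus)
  next
    case 2
    then show ?thesis using jensen_unit_circle by simp
  next
    case 3
    then have a: "a \<noteq> 0" "cmod (1 / a) < 1" by (auto simp: norm_divide divide_simps)
    have "cmod (cis x - a) = cmod a * cmod (1 - 1 / a * cis x)" for x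
    proof -
      have "cis x - a = - a * (1 - 1 / a * cis x)" using a by (simp add: field_simps)
      then show ?thesis by (simp only: norm_mult norm_minus_cancel)
    qed
    moreover have "1 - 1 / a * cis x \<noteq> 0" for x
    proof
      assume "1 - 1 / a * cis x = 0"
      then have "cis x = a" using a by (simp add: field_simps)
      then show False using 3 by (metis norm_cis less_irrefl)
    qed
    ultimately have "ln (cmod (cis x - a)) = ln (cmod a) + ln (cmod (1 - 1 / a * cis x))" for x
      using a by (simp add: ln_mult)
    moreover have "((\<lambda>t. ln (cmod a) + ln (cmod (1 - 1 / a * cis (2 * pi * t)))) has_integral ln (cmod a) + 0) {0..1}"
      using has_integral_const_real[of "ln (cmod a)" 0 1] by (intro has_integral_add jensen_inside a) simp
    ultimately show ?thesis using 3 by simp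
  qed
qed

lemma finite_cis_in: "finite A \<Longrightarrow> finite {t \<in> {0..1::real}. cis (2 * pi * t) \<in> A}"
proof -
  assume "finite A"
  moreover have "{t \<in> {0..1::real}. cis (2 * pi * t) \<in> A} = (\<Union>a\<in>A. {t \<in> {0..1}. cis (2 * pi * t) = a})" by auto
  ultimately show ?thesis using finite_cis_eq by auto
qed

lemma jensen_prod:
  "((\<lambda>t. ln (cmod (\<Prod>x\<in>#M. (cis (2 * pi * t) - x)))) has_integral (\<Sum>x\<in>#M. ln (max 1 (cmod x)))) {0..1}"
proof (induction M)
  case empty
  show ?case by simp
next
  case (add x M)
  have "((\<lambda>t. ln (cmod (cis (2 * pi * t) - x)) + ln (cmod (\<Prod>x\<in>#M. (cis (2 * pi * t) - x)))) has_integral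
      ln (max 1 (cmod x)) + (\<Sum>x\<in>#M. ln (max 1 (cmod x)))) {0..1}"
    by (intro has_integral_add jensen_linear add.IH)
  then have "((\<lambda>t. ln (cmod (\<Prod>x\<in>#add_mset x M. (cis (2 * pi * t) - x)))) has_integral
      ln (max 1 (cmod x)) + (\<Sum>x\<in>#M. ln (max 1 (cmod x)))) {0..1}"
  proof (rule has_integral_spike_finite[rotated 2])
    show "finite {t \<in> {0..1::real}. cis (2 * pi * t) \<in> insert x (set_mset M)}" by (intro finite_cis_in) simp
    fix t assume t: "t \<in> {0..1::real} - {t \<in> {0..1::real}. cis (2 * pi * t) \<in> insert x (set_mset M)}"
    then have "(\<Prod>x\<in>#M. (cis (2 * pi * t) - x)) \<noteq> 0" "cis (2 * pi * t) - x \<noteq> 0"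
      by (auto simp: prod_mset_zero_iff)
    then show "ln (cmod (\<Prod>x\<in>#add_mset x M. (cis (2 * pi * t) - x))) =
       ln (cmod (cis (2 * pi * t) - x)) + ln (cmod (\<Prod>x\<in>#M. (cis (2 * pi * t) - x)))"
      by (simp add: norm_mult ln_mult)
  qed
  then show ?case by simp
qed

text \<open>Jensen's formula for polynomials.  The integrand is redefined at the finitely many zeros on the circle, where
  the logarithm of a product is not the sum of the logarithms.\<close>

lemma jensen_poly:
  fixes F :: "complex poly"
  assumes "F \<noteq> 0"
  shows "((\<lambda>t. ln (cmod (poly F (cis (2 * pi * t))))) has_integral
    ln (cmod (lead_coeff F)) + (\<Sum>x\<in>#proots F. ln (max 1 (cmod x)))) {0..1}"
proof -
  have "((\<lambda>t. ln (cmod (lead_coeff F)) + ln (cmod (\<Prod>x\<in>#proots F. (cis (2 * pi * t) - x)))) has_integral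
    ln (cmod (lead_coeff F)) + (\<Sum>x\<in>#proots F. ln (max 1 (cmod x)))) {0..1}"
    using has_integral_const_real[of "ln (cmod (lead_coeff F))" 0 1]
    by (intro has_integral_add jensen_prod) simp
  then show ?thesis
  proof (rule has_integral_spike_finite[rotated 2])
    show "finite {t \<in> {0..1::real}. cis (2 * pi * t) \<in> set_mset (proots F)}" by (intro finite_cis_in) simp
    fix t assume "t \<in> {0..1::real} - {t \<in> {0..1::real}. cis (2 * pi * t) \<in> set_mset (proots F)}"
    then have "(\<Prod>x\<in>#proots F. (cis (2 * pi * t) - x)) \<noteq> 0"
      by (auto simp: prod_mset_zero_iff)
    then show "ln (cmod (poly F (cis (2 * pi * t)))) =
      ln (cmod (lead_coeff F)) + ln (cmod (\<Prod>x\<in>#proots F. (cis (2 * pi * t) - x)))"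
      using assms by (subst poly_eq_prod_roots) (simp add: norm_mult ln_mult)
  qed
qed

lemma log_mahler_integrable:
  assumes "P \<noteq> 0"
  shows "(\<lambda>t. ln (cmod (poly (cpoly P) (cis (2 * pi * t))))) integrable_on {0..1}"
  using jensen_poly[of "cpoly P"] assms by (auto simp: integrable_on_def)

lemma log_mahler_eq:
  assumes "P \<noteq> 0"
  shows "log_mahler P = ln \<bar>of_int (lead_coeff P)\<bar> + (\<Sum>x\<in>#proots (cpoly P). ln (max 1 (cmod x)))"
  using jensen_poly[of "cpoly P"] assms unfolding log_mahler_def by (simp add: integral_unique)

lemma sum_mset_nonneg': "(\<And>x. x \<in># M \<Longrightarrow> f x \<ge> 0) \<Longrightarrow> (\<Sum>x\<in>#M. f x :: real) \<ge> 0"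
  by (induction M) auto

lemma log_mahler_ge_lead_coeff: "P \<noteq> 0 \<Longrightarrow> ln \<bar>of_int (lead_coeff P)\<bar> \<le> log_mahler P"
  by (simp add: log_mahler_eq sum_mset_nonneg')

lemma ln_abs_int_nonneg: "c \<noteq> 0 \<Longrightarrow> 0 \<le> ln \<bar>real_of_int c\<bar>"
  by (intro ln_ge_zero) linarith

lemma log_mahler_nonneg: "P \<noteq> 0 \<Longrightarrow> 0 \<le> log_mahler P"
  by (rule order_trans[OF ln_abs_int_nonneg log_mahler_ge_lead_coeff]) auto

lemma log_mahler_mult: "P \<noteq> 0 \<Longrightarrow> Q \<noteq> 0 \<Longrightarrow> log_mahler (P * Q) = log_mahler P + log_mahler Q"
  by (simp add: log_mahler_eq cpoly_simps proots_mult lead_coeff_mult abs_mult ln_mult)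

lemma log_mahler_one: "log_mahler 1 = 0"
  by (simp add: log_mahler_def)

lemma log_mahler_power: "P \<noteq> 0 \<Longrightarrow> log_mahler (P ^ n) = n * log_mahler P"
  by (induction n) (auto simp: log_mahler_one log_mahler_mult algebra_simps)

lemma log_mahler_mono_dvd: "A dvd P \<Longrightarrow> P \<noteq> 0 \<Longrightarrow> log_mahler A \<le> log_mahler P"
  by (auto simp: log_mahler_mult log_mahler_nonneg elim!: dvdE)

lemma log_mahler_le:
  assumes "P \<noteq> 0" "\<And>z. cmod z = 1 \<Longrightarrow> cmod (poly (cpoly P) z) \<le> L" "L \<ge> 1"
  shows "log_mahler P \<le> ln L"
proof -
  have "log_mahler P \<le> integral {0..1} (\<lambda>t::real. ln L)"
    unfolding log_mahler_def
  proof (rule integral_le[OF log_mahler_integrable[OF assms(1)]])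
    fix t :: real
    have "cmod (poly (cpoly P) (cis (2 * pi * t))) \<le> L" by (intro assms) simp
    then show "ln (cmod (poly (cpoly P) (cis (2 * pi * t)))) \<le> ln L"
      using assms(3) by (cases "poly (cpoly P) (cis (2 * pi * t)) = 0") (auto intro: ln_mono)
  qed auto
  then show ?thesis by simp
qed

text \<open>The multiplicative Mahler measure, in the form in which it enters products over the roots.\<close>

lemma exp_log_mahler:
  assumes "P \<noteq> 0"
  shows "exp (log_mahler P) = \<bar>of_int (lead_coeff P)\<bar> * (\<Prod>x\<in>#proots (cpoly P). max 1 (cmod x))"
proof -
  have "exp (\<Sum>x\<in>#M. ln (max 1 (cmod x))) = (\<Prod>x\<in>#M. max 1 (cmod x))" for M
    by (induction M) (auto simp: exp_add)
  then show ?thesis using assms by (simp add: log_mahler_eq exp_add)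
qed

section \<open>Minimal polynomials and field embeddings\<close>

text \<open>A common root makes the resultant vanish, so the greatest common divisor over \<open>\<int>\<close> is not
  constant.\<close>

lemma irreducible_dvd_if_root:
  fixes A Q :: "int poly"
  assumes "irreducible A" "poly (cpoly A) z = 0" "poly (cpoly Q) z = 0"
  shows "A dvd Q"
proof (cases "Q = 0")
  case False
  have A0: "A \<noteq> 0" using assms(1) by auto
  have "z \<in># proots (cpoly A)" using A0 assms(2) by simp
  then have "(\<Prod>x\<in>#proots (cpoly A). poly (cpoly Q) x) = 0"
    using assms(3) by (auto simp: prod_mset_zero_iff)
  then have "complex_of_int (resultant A Q) = 0" using of_int_resultant[OF A0 False] by simp
  then have "resultant A Q = 0" by simp
  then have "degree (gcd A Q) \<noteq> 0" by (simp add: resultant_0_gcd)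
  then have "\<not> is_unit (gcd A Q)" by (auto simp: is_unit_poly_iff)
  then have "A dvd gcd A Q" using assms(1) irreducibleD' by blast
  then show ?thesis by simp
qed auto

text \<open>Prime elements of \<open>\<int>[X]\<close> are normalised by the sign of the leading coefficient.\<close>

lemma lead_coeff_prime_int_poly:
  fixes p :: "int poly"
  assumes "prime p"
  shows "lead_coeff p \<ge> 1"
proof -
  have "p \<noteq> 0" "normalize p = p" using assms by (auto simp: prime_def)
  then have "lead_coeff p = lead_coeff p div sgn (lead_coeff p)"
    using coeff_normalize[of p "degree p"] by simp
  moreover have "lead_coeff p \<noteq> 0" using \<open>p \<noteq> 0\<close> by simp
  ultimately show ?thesis by (cases "lead_coeff p > 0") (auto simp: sgn_if)
qed

lemma irreducible_factor_root:
  fixes P :: "int poly"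
  assumes "P \<noteq> 0" "poly (cpoly P) z = 0"
  shows "\<exists>A. irreducible A \<and> lead_coeff A \<ge> 1 \<and> A dvd P \<and> poly (cpoly A) z = 0"
  using assms
proof (induction P rule: prime_divisors_induct)
  case (unit P)
  then show ?case by (auto simp: is_unit_poly_iff)
next
  case (factor p P)
  have "irreducible p" using factor.hyps by (intro prime_elem_imp_irreducible prime_imp_prime_elem)
  moreover have "lead_coeff p \<ge> 1" using factor.hyps by (intro lead_coeff_prime_int_poly)
  ultimately have p: "irreducible p" "lead_coeff p \<ge> 1" by blast+
  show ?case
  proof (cases "poly (cpoly p) z = 0")
    case True
    then show ?thesis using p by (intro exI[of _ p]) simp
  next
    case False
    then have "poly (cpoly P) z = 0" "P \<noteq> 0" using factor.prems by (auto simp: cpoly_simps)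
    then obtain A where "irreducible A" "lead_coeff A \<ge> 1" "A dvd P" "poly (cpoly A) z = 0"
      using factor.IH by blast
    then show ?thesis by (intro exI[of _ A]) simp
  qed
qed auto

lemma int_min_poly_eqI:
  assumes "irreducible A" "poly (cpoly A) \<alpha> = 0" "lead_coeff A \<ge> 1"
  shows "int_min_poly \<alpha> = A"
  unfolding int_min_poly_def
proof (rule the_equality)
  fix B assume B: "irreducible B \<and> poly (cpoly B) \<alpha> = 0 \<and> lead_coeff B \<ge> 1"
  have "A dvd B" "B dvd A" using irreducible_dvd_if_root assms B by blast+
  from \<open>A dvd B\<close> obtain U where U: "B = A * U" by (rule dvdE)
  from \<open>B dvd A\<close> obtain V where V: "A = B * V" by (rule dvdE)
  have "A \<noteq> 0" using assms(1) by auto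
  have "A * (U * V) = A * 1" using V unfolding U by (simp only: mult.assoc mult_1_right)
  then have "U * V = 1" using \<open>A \<noteq> 0\<close> by (simp only: mult_cancel_left) simp
  then have "is_unit U" by (intro dvdI[of 1 U V]) simp
  then obtain u where u: "U = [:u:]" "is_unit u" by (auto simp: is_unit_poly_iff)
  then have "lead_coeff B = u * lead_coeff A" using U by simp
  moreover have "u = 1 \<or> u = -1" using u(2) by auto
  ultimately have "u = 1" using assms(3) B by auto
  then show "B = A" unfolding U u(1) by simp
next
  show "irreducible A \<and> poly (cpoly A) \<alpha> = 0 \<and> lead_coeff A \<ge> 1" using assms by (intro conjI)
qed

lemma int_min_poly_props:
  assumes "algebraic \<alpha>"
  shows "irreducible (int_min_poly \<alpha>)" "poly (cpoly (int_min_poly \<alpha>)) \<alpha> = 0" "lead_coeff (int_min_poly \<alpha>) \<ge> 1"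
proof -
  obtain P where P: "P \<noteq> 0" "poly (cpoly P) \<alpha> = 0" using assms by (rule algebraicE')
  from irreducible_factor_root[OF P]
  obtain A where "irreducible A \<and> lead_coeff A \<ge> 1 \<and> A dvd P \<and> poly (cpoly A) \<alpha> = 0" by (rule exE)
  then have A: "irreducible A" "lead_coeff A \<ge> 1" "poly (cpoly A) \<alpha> = 0" by simp_all
  have eq: "int_min_poly \<alpha> = A" by (rule int_min_poly_eqI[OF A(1,3,2)])
  show "irreducible (int_min_poly \<alpha>)" "poly (cpoly (int_min_poly \<alpha>)) \<alpha> = 0" "lead_coeff (int_min_poly \<alpha>) \<ge> 1"
    unfolding eq by (rule A)+
qed

lemma degree_pos_if_root:
  assumes "P \<noteq> 0" "poly (cpoly P) z = 0"
  shows "degree P > 0"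
proof (rule ccontr)
  assume "\<not> degree P > 0"
  then obtain c where "P = [:c:]" by (metis degree_eq_zeroE neq0_conv)
  then show False using assms by simp
qed

lemma irreducible_rsquarefree:
  fixes A :: "int poly"
  assumes "irreducible A" "degree A > 0"
  shows "rsquarefree (cpoly A)"
  unfolding rsquarefree_roots
proof (intro allI notI, elim conjE)
  fix a assume a: "poly (cpoly A) a = 0" "poly (pderiv (cpoly A)) a = 0"
  have "pderiv (cpoly A) = cpoly (pderiv A)" by (rule of_int_hom.map_poly_pderiv[symmetric])
  then have "poly (cpoly (pderiv A)) a = 0" using a(2) by simp
  then have "A dvd pderiv A" by (rule irreducible_dvd_if_root[OF assms(1) a(1)])
  then show False using assms(2) by simp
qed

abbreviation rpoly :: "rat poly \<Rightarrow> complex poly" where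
  "rpoly r \<equiv> map_poly of_rat r"

interpretation rat_poly_hom: map_poly_inj_idom_hom "of_rat :: rat \<Rightarrow> complex" ..

lemma clear_denominators: "\<exists>c R. c > 0 \<and> map_poly rat_of_int R = smult (of_int c) r"
proof (induction r)
  case 0
  show ?case by (intro exI[of _ 1] exI[of _ 0]) auto
next
  case (pCons a r)
  then obtain c R where cR: "c > 0" "map_poly rat_of_int R = smult (of_int c) r" by auto
  obtain u v where uv: "quotient_of a = (u, v)" by force
  then have a: "a = of_int u / of_int v" "v > 0"
    using quotient_of_div quotient_of_denom_pos by blast+
  have "map_poly rat_of_int (pCons (c * u) (smult v R)) = smult (of_int (c * v)) (pCons a r)"
    using a(2) unfolding of_int_hom.map_poly_pCons_hom of_int_hom.map_poly_hom_smult cR(2)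
    by (simp add: a(1) mult.commute)
  moreover have "c * v > 0" using cR a by simp
  ultimately show ?case by blast
qed

lemma rpoly_of_int: "rpoly (map_poly of_int R) = cpoly R"
  by (intro poly_eqI) (simp add: coeff_map_poly)

lemma rpoly_clear_denominators:
  "\<exists>c R. c \<noteq> 0 \<and> degree R = degree r \<and> cpoly R = smult (of_int c) (rpoly r)"
proof -
  obtain c R where cR: "c > 0" "map_poly rat_of_int R = smult (of_int c) r"
    using clear_denominators by blast
  have "rpoly (map_poly rat_of_int R) = smult (of_rat (of_int c)) (rpoly r)"
    unfolding cR(2) by (rule of_rat_hom.map_poly_hom_smult)
  then have "cpoly R = smult (of_int c) (rpoly r)" by (simp add: rpoly_of_int)
  moreover have "degree R = degree r" using arg_cong[OF cR(2), of degree] cR(1) by simp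
  ultimately show ?thesis using cR(1) by (intro exI[of _ c] exI[of _ R]) simp
qed

text \<open>Rational relations satisfied by one root of \<open>A\<close> hold for all of them; this makes the embedding
  \<open>\<alpha> \<mapsto> z\<close> well defined.\<close>

lemma rpoly_root_transfer:
  assumes "irreducible A" "poly (cpoly A) \<alpha> = 0" "poly (rpoly r) \<alpha> = 0" "poly (cpoly A) z = 0"
  shows "poly (rpoly r) z = 0"
proof -
  obtain c R where cR: "c \<noteq> 0" "degree R = degree r" "cpoly R = smult (of_int c) (rpoly r)"
    using rpoly_clear_denominators by blast
  have "poly (cpoly R) \<alpha> = 0" using assms(3) by (simp add: cR(3))
  then have "A dvd R" using irreducible_dvd_if_root assms by blast
  then have "poly (cpoly R) z = 0" using assms(4) by (auto simp: cpoly_simps)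
  then show ?thesis using cR(1) unfolding cR(3) by simp
qed

lemma rpoly_degree_ge:
  assumes "irreducible A" "poly (cpoly A) \<alpha> = 0" "poly (rpoly r) \<alpha> = 0" "r \<noteq> 0"
  shows "degree A \<le> degree r"
proof -
  obtain c R where cR: "c \<noteq> 0" "degree R = degree r" "cpoly R = smult (of_int c) (rpoly r)"
    using rpoly_clear_denominators by blast
  have "poly (cpoly R) \<alpha> = 0" using assms(3) by (simp add: cR(3))
  then have "A dvd R" using irreducible_dvd_if_root assms by blast
  moreover have "R \<noteq> 0" using cR(1,3) assms(4) by auto
  ultimately show ?thesis using dvd_imp_degree_le cR(2) by metis
qed

lemma rpoly_bezout:
  assumes "irreducible p" "poly (rpoly p) \<alpha> = 0" "\<not> p dvd r"
  shows "\<exists>u. poly (rpoly u) \<alpha> * poly (rpoly r) \<alpha> = 1"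
proof -
  have "coprime p r"
  proof (rule coprimeI)
    fix c assume c: "c dvd p" "c dvd r"
    show "is_unit c"
    proof (rule ccontr)
      assume "\<not> is_unit c"
      then have "p dvd c" using irreducibleD'[OF assms(1) c(1)] by blast
      then show False using dvd_trans c(2) assms(3) by blast
    qed
  qed
  then have "fst (bezout_coefficients p r) * p + snd (bezout_coefficients p r) * r = 1"
    by (simp add: bezout_coefficients_fst_snd)
  then have "poly (rpoly (fst (bezout_coefficients p r) * p + snd (bezout_coefficients p r) * r)) \<alpha> = 1" by simp
  then show ?thesis using assms(2) by (auto simp: rat_poly_hom.hom_add rat_poly_hom.hom_mult)
qed

text \<open>The \<open>\<int>\<close>-minimal polynomial made monic stays irreducible over \<open>\<rat>\<close>: in any factorisation one factor has
  the root \<open>\<alpha>\<close> and hence full degree.\<close>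

lemma rat_irreducible_exists:
  assumes "algebraic \<alpha>"
  shows "\<exists>p. irreducible p \<and> lead_coeff p = 1 \<and> poly (rpoly p) \<alpha> = 0"
proof -
  define A where "A = int_min_poly \<alpha>"
  note A = int_min_poly_props[OF assms, folded A_def]
  have A0: "A \<noteq> 0" using A(1) by auto
  have dA: "degree A > 0" using degree_pos_if_root A0 A(2) by blast
  define c where "c = inverse (rat_of_int (lead_coeff A))"
  define p where "p = smult c (map_poly of_int A)"
  have c0: "c \<noteq> 0" using A0 by (simp add: c_def)
  have p0: "p \<noteq> 0" using A0 c0 by (simp add: p_def)
  have dp: "degree p = degree A" using c0 by (simp add: p_def)
  have lc: "lead_coeff p = 1" using A0 unfolding p_def by (simp add: c_def)
  have root: "poly (rpoly p) \<alpha> = 0"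
    unfolding p_def of_rat_hom.map_poly_hom_smult rpoly_of_int using A(2) by simp
  have ge: "degree A \<le> degree a" if "poly (rpoly a) \<alpha> = 0" "a \<noteq> 0" for a
    using rpoly_degree_ge[OF A(1,2) that] .
  have "irreducible p"
  proof (rule irreducibleI)
    show "p \<noteq> 0" by (rule p0)
    show "\<not> is_unit p" using dA dp by (auto simp: is_unit_poly_iff)
    fix a b assume ab: "p = a * b"
    have ab0: "a \<noteq> 0" "b \<noteq> 0" using p0 ab by auto
    have deg: "degree a + degree b = degree A" using dp unfolding ab by (simp add: degree_mult_eq ab0)
    have "poly (rpoly a) \<alpha> = 0 \<or> poly (rpoly b) \<alpha> = 0"
      using root unfolding ab by (simp add: rat_poly_hom.hom_mult)
    then have "degree b = 0 \<or> degree a = 0" using ge[of a] ge[of b] ab0 deg by auto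
    then show "is_unit a \<or> is_unit b" using ab0 by (auto simp: is_unit_iff_degree)
  qed
  then show ?thesis using lc root by blast
qed

lemma rat_min_poly_props:
  assumes "algebraic \<alpha>"
  shows "irreducible (rat_min_poly \<alpha>)" "poly (rpoly (rat_min_poly \<alpha>)) \<alpha> = 0" "lead_coeff (rat_min_poly \<alpha>) = 1"
proof -
  obtain p where p: "irreducible p" "lead_coeff p = 1" "poly (rpoly p) \<alpha> = 0"
    using rat_irreducible_exists[OF assms] by blast
  have "rat_min_poly \<alpha> = p"
    unfolding rat_min_poly_def
  proof (rule the_equality)
    fix q :: "rat poly" assume q: "irreducible q \<and> poly (rpoly q) \<alpha> = 0 \<and> lead_coeff q = 1"
    have "p dvd q" using rpoly_bezout[OF p(1,3), of q] q by auto
    moreover have "q dvd p" using rpoly_bezout[of q \<alpha> p] p q by auto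
    ultimately show "q = p" using p(2) q by (metis poly_dvd_antisym)
  qed (use p in auto)
  then show "irreducible (rat_min_poly \<alpha>)" "poly (rpoly (rat_min_poly \<alpha>)) \<alpha> = 0" "lead_coeff (rat_min_poly \<alpha>) = 1"
    using p by auto
qed

lemma not_conjugate_if_not_common_root:
  assumes "algebraic \<alpha>" "algebraic \<kappa>" "poly (cpoly A) \<alpha> = 0" "poly (cpoly A) \<kappa> \<noteq> 0"
  shows "\<not> conjugate \<alpha> \<kappa>"
proof
  assume "conjugate \<alpha> \<kappa>"
  then have eq: "rat_min_poly \<alpha> = rat_min_poly \<kappa>" by (simp add: conjugate_def)
  have "rat_min_poly \<alpha> dvd map_poly of_int A"
    using rpoly_bezout[OF rat_min_poly_props(1,2)[OF assms(1)], of "map_poly of_int A"] assms(3)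
    by (auto simp: rpoly_of_int)
  then have "rpoly (rat_min_poly \<alpha>) dvd cpoly A"
    unfolding rpoly_of_int[symmetric] by (rule rat_poly_hom.hom_dvd)
  then have "poly (cpoly A) \<kappa> = 0" using rat_min_poly_props(2)[OF assms(2)] by (auto simp: eq elim!: dvdE)
  then show False using assms(4) by simp
qed

lemma complex_subfield_of_rat:
  assumes "complex_subfield K" shows "of_rat q \<in> K"
proof -
  note K = assms[unfolded complex_subfield_def]
  have nat: "of_nat n \<in> K" for n by (induction n) (use K in auto)
  have int: "of_int i \<in> K" for i
    by (cases i rule: int_cases2) (use nat K in auto)
  obtain u v where "quotient_of q = (u, v)" by force
  then have "q = of_int u / of_int v" by (rule quotient_of_div)
  then have "of_rat q = (of_int u * inverse (of_int v) :: complex)"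
    by (simp add: divide_inverse of_rat_mult of_rat_inverse)
  then show ?thesis using K int by metis
qed

lemma complex_subfield_poly:
  assumes "complex_subfield K" "\<alpha> \<in> K" shows "poly (rpoly r) \<alpha> \<in> K"
proof (induction r)
  case 0
  then show ?case using assms by (simp add: complex_subfield_def)
next
  case (pCons a r)
  then show ?case using complex_subfield_of_rat[OF assms(1), of a] assms
    by (auto simp: complex_subfield_def)
qed

lemma rat_adjoin_eq:
  assumes "algebraic \<alpha>"
  shows "rat_adjoin \<alpha> = range (\<lambda>r. poly (rpoly r) \<alpha>)"
proof
  let ?R = "range (\<lambda>r. poly (rpoly r) \<alpha>)"
  have "complex_subfield ?R"
    unfolding complex_subfield_def
  proof (intro conjI ballI)
    show "0 \<in> ?R" by (rule range_eqI[of _ _ 0]) simp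
    show "1 \<in> ?R" by (rule range_eqI[of _ _ 1]) simp
    fix x y assume "x \<in> ?R" "y \<in> ?R"
    then obtain r s where rs: "x = poly (rpoly r) \<alpha>" "y = poly (rpoly s) \<alpha>" by auto
    show "x + y \<in> ?R" by (rule range_eqI[of _ _ "r + s"]) (simp add: rs rat_poly_hom.hom_add)
    show "x * y \<in> ?R" by (rule range_eqI[of _ _ "r * s"]) (simp add: rs rat_poly_hom.hom_mult)
  next
    fix x assume "x \<in> ?R"
    then obtain r where r: "x = poly (rpoly r) \<alpha>" by auto
    show "- x \<in> ?R" by (rule range_eqI[of _ _ "- r"]) (simp add: r rat_poly_hom.hom_uminus)
    show "inverse x \<in> ?R"
    proof (cases "x = 0")
      case True
      then show ?thesis by (intro range_eqI[of _ _ 0]) simp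
    next
      case False
      have "\<not> rat_min_poly \<alpha> dvd r"
      proof
        assume "rat_min_poly \<alpha> dvd r"
        then have "rpoly (rat_min_poly \<alpha>) dvd rpoly r" by (rule rat_poly_hom.hom_dvd)
        then show False using False rat_min_poly_props(2)[OF assms] by (auto simp: r elim!: dvdE)
      qed
      then obtain u where u: "poly (rpoly u) \<alpha> * x = 1"
        using rpoly_bezout[OF rat_min_poly_props(1,2)[OF assms]] r by blast
      then show ?thesis using False by (intro range_eqI[of _ _ u]) (simp add: field_simps)
    qed
  qed
  moreover have "\<alpha> \<in> ?R" by (rule range_eqI[of _ _ "[:0, 1:]"]) simp
  ultimately show "rat_adjoin \<alpha> \<subseteq> ?R" unfolding rat_adjoin_def by blast
  show "?R \<subseteq> rat_adjoin \<alpha>" unfolding rat_adjoin_def using complex_subfield_poly by auto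
qed

interpretation rat_vs: vector_space "\<lambda>(q::rat) (z::complex). of_rat q * z"
  by (rule vector_space_rat_complex)

lemma poly_rpoly_sum:
  assumes "degree r < n"
  shows "poly (rpoly r) \<alpha> = (\<Sum>i<n. of_rat (coeff r i) * \<alpha> ^ i)"
proof -
  have "poly (rpoly r) \<alpha> = (\<Sum>i\<le>degree r. of_rat (coeff r i) * \<alpha> ^ i)"
    by (simp add: poly_altdef coeff_map_poly)
  also have "\<dots> = (\<Sum>i<n. of_rat (coeff r i) * \<alpha> ^ i)"
    using assms by (intro sum.mono_neutral_left) (auto simp: coeff_eq_0)
  finally show ?thesis .
qed

lemma rat_degree_eq:
  assumes "algebraic \<alpha>"
  shows "rat_degree \<alpha> = degree (int_min_poly \<alpha>)"
proof -
  define A where "A = int_min_poly \<alpha>"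
  note A = int_min_poly_props[OF assms, folded A_def]
  define n where "n = degree A"
  define B where "B = (\<lambda>i. \<alpha> ^ i) ` {..<n}"
  have small: "r = 0" if "poly (rpoly r) \<alpha> = 0" "degree r < n" for r
    using rpoly_degree_ge[OF A(1,2) that(1)] that(2) by (auto simp: n_def)
  have lin: "q i = 0" if "(\<Sum>i<n. of_rat (q i) * \<alpha> ^ i) = 0" "i < n" for q i
  proof -
    define r where "r = (\<Sum>i<n. monom (q i) i)"
    have cr: "coeff r i = (if i < n then q i else 0)" for i
      by (simp add: r_def coeff_sum)
    have dr: "degree r < n" using that(2) by (intro degree_lessI) (auto simp: cr)
    have "poly (rpoly r) \<alpha> = (\<Sum>i<n. of_rat (q i) * \<alpha> ^ i)"
      unfolding poly_rpoly_sum[OF dr] by (simp add: cr)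
    then have "r = 0" using small dr that(1) by simp
    then show ?thesis using cr[of i] that(2) by simp
  qed
  have inj: "inj_on (\<lambda>i. \<alpha> ^ i) {..<n}"
  proof (rule inj_onI, rule ccontr)
    fix i j assume ij: "i \<in> {..<n}" "j \<in> {..<n}" "\<alpha> ^ i = \<alpha> ^ j" "i \<noteq> j"
    define q :: "nat \<Rightarrow> rat" where "q = (\<lambda>k. if k = i then 1 else if k = j then -1 else 0)"
    have "(\<Sum>k<n. of_rat (q k) * \<alpha> ^ k) = (\<Sum>k<n. (if k = i then \<alpha> ^ k else 0) - (if k = j then \<alpha> ^ k else 0))"
      using ij(4) by (intro sum.cong) (auto simp: q_def)
    also have "\<dots> = 0" using ij by (simp add: sum_subtractf)
    finally have "q i = 0" using lin ij(1) by blast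
    then show False by (simp add: q_def)
  qed
  have "rat_vs.dim (rat_adjoin \<alpha>) = n"
  proof (rule rat_vs.dim_unique)
    show "B \<subseteq> rat_adjoin \<alpha>"
      unfolding B_def rat_adjoin_eq[OF assms]
    proof
      fix x assume "x \<in> (\<lambda>i. \<alpha> ^ i) ` {..<n}"
      then obtain i where "x = \<alpha> ^ i" by auto
      then show "x \<in> range (\<lambda>r. poly (rpoly r) \<alpha>)"
        by (intro range_eqI[of _ _ "monom 1 i"]) (simp add: map_poly_monom poly_monom)
    qed
    show "card B = n" unfolding B_def by (simp add: card_image inj)
    show "rat_vs.independent B"
      unfolding rat_vs.dependent_finite[of B, unfolded B_def, OF finite_imageI[OF finite_lessThan]] B_def
    proof (rule notI, elim exE conjE bexE)
      fix u v assume uv: "v \<in> (\<lambda>i. \<alpha> ^ i) ` {..<n}" "u v \<noteq> 0" "(\<Sum>v\<in>(\<lambda>i. \<alpha> ^ i) ` {..<n}. of_rat (u v) * v) = 0"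
      then have "(\<Sum>i<n. of_rat (u (\<alpha> ^ i)) * \<alpha> ^ i) = 0"
        by (simp add: sum.reindex inj)
      then show False using lin[of "\<lambda>i. u (\<alpha> ^ i)"] uv(1,2) by auto
    qed
    show "rat_adjoin \<alpha> \<subseteq> rat_vs.span B"
    proof
      fix x assume "x \<in> rat_adjoin \<alpha>"
      then obtain r where r: "x = poly (rpoly r) \<alpha>" unfolding rat_adjoin_eq[OF assms] by auto
      define A' where "A' = map_poly rat_of_int A"
      have A'0: "A' \<noteq> 0" "degree A' = n" using A(1) by (auto simp: A'_def n_def)
      have npos: "n > 0" unfolding n_def using A degree_pos_if_root[of A \<alpha>] by auto
      define s where "s = r mod A'"
      have ds: "degree s < n"
        using degree_mod_less[of A' r] A'0 npos by (auto simp: s_def)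
      have "x = poly (rpoly (r div A' * A' + s)) \<alpha>" by (simp add: r s_def)
      also have "\<dots> = poly (rpoly s) \<alpha>"
        using A(2) by (simp add: rat_poly_hom.hom_add rat_poly_hom.hom_mult A'_def rpoly_of_int)
      also have "\<dots> = (\<Sum>i<n. of_rat (coeff s i) * \<alpha> ^ i)" by (rule poly_rpoly_sum[OF ds])
      also have "\<dots> \<in> rat_vs.span B"
        by (intro rat_vs.span_sum rat_vs.span_scale rat_vs.span_base) (auto simp: B_def)
      finally show "x \<in> rat_vs.span B" .
    qed
  qed
  then show ?thesis by (simp add: rat_degree_def n_def A_def)
qed

lemma field_embedding_of_rat_poly:
  assumes "algebraic \<alpha>" "\<sigma> \<in> field_embeddings \<alpha>"
  shows "\<sigma> (poly (rpoly r) \<alpha>) = poly (rpoly r) (\<sigma> \<alpha>)"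
proof -
  let ?K = "rat_adjoin \<alpha>"
  have sub: "poly (rpoly r) \<alpha> \<in> ?K" for r unfolding rat_adjoin_eq[OF assms(1)] by auto
  have rat: "of_rat q \<in> ?K" for q using sub[of "[:q:]"] by (cases "q = 0") (auto simp: map_poly_pCons)
  have al: "\<alpha> \<in> ?K" using sub[of "[:0,1:]"] by simp
  have one: "\<sigma> 1 = 1" and add: "\<sigma> (x + y) = \<sigma> x + \<sigma> y" and mult: "\<sigma> (x * y) = \<sigma> x * \<sigma> y"
    if "x \<in> ?K" "y \<in> ?K" for x y using assms(2) that by (auto simp: field_embeddings_def)
  have one: "\<sigma> 1 = 1" using assms(2) by (auto simp: field_embeddings_def)
  have zero: "\<sigma> 0 = 0" using add[of 0 0] rat[of 0] by simp
  have nat: "\<sigma> (of_nat n) = of_nat n" for n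
  proof (induction n)
    case (Suc n)
    have "of_nat n \<in> ?K" using rat[of "of_nat n"] by simp
    then show ?case using add[of 1 "of_nat n"] rat[of 1] Suc one by simp
  qed (simp add: zero)
  have int: "\<sigma> (of_int i) = of_int i" for i
  proof (cases i rule: int_cases2)
    case (nonneg n)
    then show ?thesis using nat by simp
  next
    case (nonpos n)
    have "of_nat n \<in> ?K" "- of_nat n \<in> ?K" using rat[of "of_nat n"] rat[of "- of_nat n"] by (auto simp: of_rat_minus)
    then have "\<sigma> (- of_nat n) + \<sigma> (of_nat n) = \<sigma> (- of_nat n + of_nat n)" using add by metis
    then have "\<sigma> (- of_nat n) = - of_nat n" by (simp add: nat zero add_eq_0_iff2)
    then show ?thesis using nonpos by simp
  qed
  have rat': "\<sigma> (of_rat q) = of_rat q" for q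
  proof -
    obtain u v where uv: "quotient_of q = (u, v)" by force
    then have q: "q = of_int u / of_int v" "v > 0" using quotient_of_div quotient_of_denom_pos by blast+
    have "of_rat q * of_int v = (of_int u :: complex)" using q by (simp add: of_rat_divide)
    moreover have "of_int v \<in> ?K" using rat[of "of_int v"] by simp
    ultimately have "\<sigma> (of_rat q) * of_int v = of_int u" using mult[of "of_rat q" "of_int v"] rat int by metis
    then have "\<sigma> (of_rat q) = of_int u / of_int v" using q(2) by (simp add: field_simps)
    also have "\<dots> = of_rat q" by (simp add: q(1) of_rat_divide)
    finally show ?thesis .
  qed
  show ?thesis
  proof (induction r)
    case 0
    then show ?case by (simp add: zero)
  next
    case (pCons a r)
    have "\<alpha> * poly (rpoly r) \<alpha> \<in> ?K" using sub[of "pCons 0 r"] by (simp add: of_rat_hom.map_poly_pCons_hom)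
    then have "\<sigma> (of_rat a + \<alpha> * poly (rpoly r) \<alpha>) = \<sigma> (of_rat a) + \<sigma> \<alpha> * \<sigma> (poly (rpoly r) \<alpha>)"
      using add[OF rat] mult[OF al sub] by simp
    then show ?case by (simp add: of_rat_hom.map_poly_pCons_hom pCons.IH rat')
  qed
qed

lemma field_embeddings_bij:
  assumes "algebraic \<alpha>"
  shows "bij_betw (\<lambda>\<sigma>. \<sigma> \<alpha>) (field_embeddings \<alpha>) {z. poly (cpoly (int_min_poly \<alpha>)) z = 0}"
proof -
  define A where "A = int_min_poly \<alpha>"
  note A = int_min_poly_props[OF assms, folded A_def]
  note emb = field_embedding_of_rat_poly[OF assms]
  note adj = rat_adjoin_eq[OF assms]
  have "bij_betw (\<lambda>\<sigma>. \<sigma> \<alpha>) (field_embeddings \<alpha>) {z. poly (cpoly A) z = 0}"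
    unfolding bij_betw_def
  proof (intro conjI equalityI subsetI)
    show "inj_on (\<lambda>\<sigma>. \<sigma> \<alpha>) (field_embeddings \<alpha>)"
    proof (rule inj_onI)
      fix \<sigma> \<tau> assume st: "\<sigma> \<in> field_embeddings \<alpha>" "\<tau> \<in> field_embeddings \<alpha>" "\<sigma> \<alpha> = \<tau> \<alpha>"
      show "\<sigma> = \<tau>"
      proof (rule extensionalityI[of _ "rat_adjoin \<alpha>"])
        show "\<sigma> \<in> extensional (rat_adjoin \<alpha>)" "\<tau> \<in> extensional (rat_adjoin \<alpha>)"
          using st by (auto simp: field_embeddings_def)
        show "\<sigma> x = \<tau> x" if x: "x \<in> rat_adjoin \<alpha>" for x
        proof -
          obtain r where "x = poly (rpoly r) \<alpha>" using x unfolding adj by auto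
          then show ?thesis using emb[OF st(1), of r] emb[OF st(2), of r] st(3) by simp
        qed
      qed
    qed
  next
    fix z assume "z \<in> (\<lambda>\<sigma>. \<sigma> \<alpha>) ` field_embeddings \<alpha>"
    then obtain \<sigma> where s: "\<sigma> \<in> field_embeddings \<alpha>" "z = \<sigma> \<alpha>" by auto
    have "poly (cpoly A) z = \<sigma> (poly (cpoly A) \<alpha>)"
      using emb[OF s(1), of "map_poly of_int A"] by (simp add: rpoly_of_int s)
    also have "\<dots> = 0" using A(2) emb[OF s(1), of 0] by simp
    finally show "z \<in> {z. poly (cpoly A) z = 0}" by simp
  next
    fix z assume "z \<in> {z. poly (cpoly A) z = 0}"
    then have z: "poly (cpoly A) z = 0" by simp
    have trans: "poly (rpoly r) z = poly (rpoly s) z" if "poly (rpoly r) \<alpha> = poly (rpoly s) \<alpha>" for r s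
      using rpoly_root_transfer[OF A(1,2), of "r - s" z] that z by (simp add: rat_poly_hom.hom_minus)
    define \<sigma> where "\<sigma> = restrict (\<lambda>x. poly (rpoly (SOME r. poly (rpoly r) \<alpha> = x)) z) (rat_adjoin \<alpha>)"
    have s: "\<sigma> (poly (rpoly r) \<alpha>) = poly (rpoly r) z" for r
    proof -
      have "poly (rpoly (SOME s. poly (rpoly s) \<alpha> = poly (rpoly r) \<alpha>)) \<alpha> = poly (rpoly r) \<alpha>"
        by (rule someI[of "\<lambda>s. poly (rpoly s) \<alpha> = poly (rpoly r) \<alpha>" r]) simp
      from trans[OF this] show ?thesis by (simp add: \<sigma>_def adj)
    qed
    have "\<sigma> \<in> field_embeddings \<alpha>"
      unfolding field_embeddings_def adj
    proof (intro CollectI conjI ballI)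
      show "\<sigma> \<in> extensional (range (\<lambda>r. poly (rpoly r) \<alpha>))" by (simp add: \<sigma>_def adj)
      show "\<sigma> 1 = 1" using s[of 1] by simp
      fix x y assume "x \<in> range (\<lambda>r. poly (rpoly r) \<alpha>)" "y \<in> range (\<lambda>r. poly (rpoly r) \<alpha>)"
      then obtain r t where rt: "x = poly (rpoly r) \<alpha>" "y = poly (rpoly t) \<alpha>" by auto
      show "\<sigma> (x + y) = \<sigma> x + \<sigma> y" using s[of "r + t"] s[of r] s[of t] by (simp add: rt rat_poly_hom.hom_add)
      show "\<sigma> (x * y) = \<sigma> x * \<sigma> y" using s[of "r * t"] s[of r] s[of t] by (simp add: rt rat_poly_hom.hom_mult)
    qed
    moreover have "\<sigma> \<alpha> = z" using s[of "[:0, 1:]"] by simp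
    ultimately show "z \<in> (\<lambda>\<sigma>. \<sigma> \<alpha>) ` field_embeddings \<alpha>" by (metis image_eqI)
  qed
  then show ?thesis by (simp add: A_def)
qed

text \<open>The embeddings send \<open>\<alpha>\<close> bijectively to the roots of \<open>A\<close>, which are simple, so the sum of logarithms is
  the logarithm of \<open>|A(\<kappa>)| / lc(A)\<close>.\<close>

lemma mean_log_dist_eq:
  assumes "irreducible A" "poly (cpoly A) \<alpha> = 0" "lead_coeff A \<ge> 1" "poly (cpoly A) \<kappa> \<noteq> 0"
  shows "mean_log_dist \<kappa> \<alpha> = (ln (cmod (poly (cpoly A) \<kappa>)) - ln (of_int (lead_coeff A))) / degree A"
proof -
  have A0: "A \<noteq> 0" using assms(1) by auto
  have alg: "algebraic \<alpha>" using assms(2) A0 by (intro algebraicI[of "cpoly A"]) auto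
  have min: "int_min_poly \<alpha> = A" using int_min_poly_eqI assms by blast
  have dA: "degree A > 0" using degree_pos_if_root A0 assms(2) by blast
  have "(\<Sum>\<sigma>\<in>field_embeddings \<alpha>. ln (cmod (\<sigma> \<alpha> - \<kappa>))) = (\<Sum>z\<in>{z. poly (cpoly A) z = 0}. ln (cmod (z - \<kappa>)))"
    using sum.reindex_bij_betw[OF field_embeddings_bij[OF alg], of "\<lambda>z. ln (cmod (z - \<kappa>))"] by (simp add: min)
  also have "\<dots> = ln (cmod (poly (cpoly A) \<kappa>)) - ln (of_int (lead_coeff A))"
  proof -
    have fin: "finite {z. poly (cpoly A) z = 0}" using A0 by (intro poly_roots_finite) auto
    have nz: "cmod (z - \<kappa>) \<noteq> 0" if "poly (cpoly A) z = 0" for z using that assms(4) by auto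
    have "poly (cpoly A) \<kappa> = poly (smult (lead_coeff (cpoly A)) (\<Prod>z | poly (cpoly A) z = 0. [:- z, 1:])) \<kappa>"
      using complex_poly_decompose_rsquarefree[OF irreducible_rsquarefree[OF assms(1) dA]] by simp
    then have "poly (cpoly A) \<kappa> = of_int (lead_coeff A) * (\<Prod>z | poly (cpoly A) z = 0. \<kappa> - z)"
      by (simp add: poly_prod)
    then have "cmod (poly (cpoly A) \<kappa>) = of_int (lead_coeff A) * (\<Prod>z | poly (cpoly A) z = 0. cmod (z - \<kappa>))"
      using assms(3) by (simp add: norm_mult norm_minus_commute flip: prod_norm)
    moreover have "ln (of_int (lead_coeff A) * (\<Prod>z | poly (cpoly A) z = 0. cmod (z - \<kappa>))) =
        ln (of_int (lead_coeff A)) + (\<Sum>z | poly (cpoly A) z = 0. ln (cmod (z - \<kappa>)))"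
    proof -
      have "(\<Prod>z | poly (cpoly A) z = 0. cmod (z - \<kappa>)) > 0" using nz by (intro prod_pos) (auto simp: less_le)
      moreover have "ln (\<Prod>z | poly (cpoly A) z = 0. cmod (z - \<kappa>)) = (\<Sum>z | poly (cpoly A) z = 0. ln (cmod (z - \<kappa>)))"
        using nz fin by (intro ln_prod) auto
      ultimately show ?thesis using assms(3) A0 by (simp add: ln_mult)
    qed
    ultimately show ?thesis by simp
  qed
  finally show ?thesis unfolding mean_log_dist_def by (simp add: rat_degree_eq[OF alg] min)
qed

lemma weil_height_eq:
  assumes "irreducible A" "poly (cpoly A) \<alpha> = 0" "lead_coeff A \<ge> 1"
  shows "weil_height \<alpha> = log_mahler A / degree A"
  using int_min_poly_eqI[OF assms] by (simp add: weil_height_def)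

section \<open>Lengths of polynomials and sizes of resultants\<close>

text \<open>The sum of the moduli of the coefficients.  It bounds the values on the unit circle, which, unlike Mahler
  measures, can be added.\<close>

definition poly_length :: "complex poly \<Rightarrow> real" where
  "poly_length p = (\<Sum>i\<le>degree p. cmod (coeff p i))"

lemma poly_length_eq: "degree p \<le> n \<Longrightarrow> poly_length p = (\<Sum>i\<le>n. cmod (coeff p i))"
  unfolding poly_length_def by (intro sum.mono_neutral_left) (auto simp: coeff_eq_0)

lemma poly_length_nonneg: "poly_length p \<ge> 0"
  unfolding poly_length_def by (intro sum_nonneg) auto

lemma poly_length_smult: "poly_length (smult c p) = cmod c * poly_length p"
  by (cases "c = 0") (auto simp: poly_length_def norm_mult sum_distrib_left)

lemma cmod_poly_le_length:
  assumes "degree p \<le> n"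
  shows "cmod (poly p z) \<le> poly_length p * max 1 (cmod z) ^ n"
proof -
  have "cmod (poly p z) \<le> (\<Sum>i\<le>degree p. cmod (coeff p i * z ^ i))"
    unfolding poly_altdef by (rule norm_sum)
  also have "\<dots> \<le> (\<Sum>i\<le>degree p. cmod (coeff p i) * max 1 (cmod z) ^ n)"
  proof (rule sum_mono)
    fix i assume i: "i \<in> {..degree p}"
    have "cmod z ^ i \<le> max 1 (cmod z) ^ i" by (intro power_mono) auto
    also have "\<dots> \<le> max 1 (cmod z) ^ n" using i assms by (intro power_increasing) auto
    finally show "cmod (coeff p i * z ^ i) \<le> cmod (coeff p i) * max 1 (cmod z) ^ n"
      by (simp add: norm_mult norm_power mult_left_mono)
  qed
  finally show ?thesis by (simp add: poly_length_def sum_distrib_right)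
qed

lemma coeff_linear_mult:
  "coeff ([:- a, 1:] * Q) 0 = - a * coeff Q 0"
  "coeff ([:- a, 1:] * Q) (Suc j) = coeff Q j - a * coeff Q (Suc j)"
  for a :: complex
  by (simp_all)

text \<open>The quotient is computed from the top coefficient downwards if \<open>|a| \<le> 1\<close> and from the constant
  coefficient upwards otherwise.  In the chosen direction the recursion multiplies only by numbers of modulus
  at most \<open>1\<close>, so nothing grows.\<close>

lemma coeff_linear_quotient_le:
  fixes Q :: "complex poly"
  assumes "P = [:- a, 1:] * Q"
  shows "cmod (coeff Q j) \<le> poly_length P"
proof (cases "Q = 0")
  case True
  then show ?thesis by (simp add: poly_length_nonneg)
next
  case False
  define N where "N = degree P"
  have N: "N = Suc (degree Q)" unfolding N_def assms using False by (subst degree_mult_eq) auto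
  show ?thesis
  proof (cases "j \<ge> N")
    case True
    then have "coeff Q j = 0" by (intro coeff_eq_0) (simp add: N)
    then show ?thesis by (simp add: poly_length_nonneg)
  next
    case jN: False
    show ?thesis
    proof (cases "cmod a \<le> 1")
      case True
      have "cmod (coeff Q j) \<le> (\<Sum>i\<in>{Suc j..N}. cmod (coeff P i))" if "j \<le> N" for j
        using that
      proof (induction j rule: inc_induct)
        case base
        then show ?case by (simp add: N coeff_eq_0)
      next
        case (step n)
        have "coeff Q n = coeff P (Suc n) + a * coeff Q (Suc n)"
          unfolding assms coeff_linear_mult by simp
        then have "cmod (coeff Q n) \<le> cmod (coeff P (Suc n)) + cmod (a * coeff Q (Suc n))"
          using norm_triangle_ineq by simp
        also have "cmod (a * coeff Q (Suc n)) \<le> cmod (coeff Q (Suc n))"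
          unfolding norm_mult using True by (intro mult_left_le_one_le) auto
        also have "\<dots> \<le> (\<Sum>i\<in>{Suc (Suc n)..N}. cmod (coeff P i))" by (rule step.IH)
        also have "cmod (coeff P (Suc n)) + \<dots> = (\<Sum>i\<in>{Suc n..N}. cmod (coeff P i))"
          using step.hyps by (intro sum.atLeast_Suc_atMost[symmetric]) auto
        finally show ?case by simp
      qed
      from this[of j] have "cmod (coeff Q j) \<le> (\<Sum>i\<in>{Suc j..N}. cmod (coeff P i))" using jN by simp
      also have "\<dots> \<le> poly_length P" unfolding poly_length_def N_def by (intro sum_mono2) auto
      finally show ?thesis .
    next
      case False
      have "cmod (coeff Q j) \<le> (\<Sum>i\<le>j. cmod (coeff P i))" for j
      proof (induction j)
        case 0
        have "1 * cmod (coeff Q 0) \<le> cmod a * cmod (coeff Q 0)"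
          using False by (intro mult_right_mono) auto
        moreover have "cmod (coeff P 0) = cmod a * cmod (coeff Q 0)"
          unfolding assms coeff_linear_mult by (simp add: norm_mult)
        ultimately show ?case by simp
      next
        case (Suc j)
        have "a * coeff Q (Suc j) = coeff Q j - coeff P (Suc j)"
          unfolding assms coeff_linear_mult by simp
        then have "cmod a * cmod (coeff Q (Suc j)) \<le> cmod (coeff Q j) + cmod (coeff P (Suc j))"
          by (metis norm_mult norm_triangle_ineq4)
        moreover have "1 * cmod (coeff Q (Suc j)) \<le> cmod a * cmod (coeff Q (Suc j))"
          using False by (intro mult_right_mono) auto
        ultimately show ?case using Suc.IH by simp
      qed
      from this[of j] have "cmod (coeff Q j) \<le> (\<Sum>i\<le>j. cmod (coeff P i))" .
      also have "\<dots> \<le> poly_length P" unfolding poly_length_def using jN by (intro sum_mono2) (auto simp: N_def)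
      finally show ?thesis .
    qed
  qed
qed

lemma poly_length_linear_quotient:
  assumes "P = [:- a, 1:] * Q" "degree P \<le> D"
  shows "poly_length Q \<le> real (D + 1) * poly_length P"
proof -
  have "degree Q \<le> D"
  proof (cases "Q = 0")
    case False
    then have "degree P = degree [:- a, 1:] + degree Q" unfolding assms(1) by (intro degree_mult_eq) auto
    then show ?thesis using assms(2) by simp
  qed simp
  then have "poly_length Q = (\<Sum>i\<le>D. cmod (coeff Q i))" by (rule poly_length_eq)
  also have "\<dots> \<le> (\<Sum>i\<le>D. poly_length P)" by (intro sum_mono coeff_linear_quotient_le[OF assms(1)])
  finally show ?thesis by simp
qed

lemma poly_length_roots_quotient:
  assumes "P = (\<Prod>x\<in>#M. [:- x, 1:]) * Q" "degree P \<le> D"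
  shows "poly_length Q \<le> real (D + 1) ^ size M * poly_length P"
  using assms
proof (induction M arbitrary: P)
  case empty
  then show ?case by simp
next
  case (add x M)
  define P1 where "P1 = (\<Prod>x\<in>#M. [:- x, 1:]) * Q"
  have P: "P = [:- x, 1:] * P1" using add.prems(1) by (simp add: P1_def mult.assoc del: mult_pCons_left)
  have "degree P1 \<le> D"
  proof (cases "P1 = 0")
    case False
    then have "degree P = 1 + degree P1" unfolding P by (subst degree_mult_eq) auto
    then show ?thesis using add.prems(2) by simp
  qed auto
  from add.IH[OF P1_def this]
  have "poly_length Q \<le> real (D + 1) ^ size M * poly_length P1" .
  also have "\<dots> \<le> real (D + 1) ^ size M * (real (D + 1) * poly_length P)"
    by (intro mult_left_mono poly_length_linear_quotient[OF P] add.prems) auto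
  finally show ?case by (simp add: mult_ac)
qed

text \<open>Dividing out the roots one by one costs a factor \<open>D + 1\<close> each.  This is the reason why division by
  \<open>f^j\<close> is harmless: for \<open>j\<close> of order \<open>n\<close> the loss is only \<open>exp(O(n log n))\<close>.\<close>

lemma poly_length_int_quotient:
  fixes F Q :: "int poly"
  assumes "F \<noteq> 0" "degree (F * Q) \<le> D"
  shows "poly_length (cpoly Q) \<le> real (D + 1) ^ degree F * poly_length (cpoly (F * Q))"
proof -
  let ?l = "of_int (lead_coeff F) :: complex"
  have "cpoly (F * Q) = smult ?l (\<Prod>x\<in>#proots (cpoly F). [:- x, 1:]) * cpoly Q"
    using complex_poly_decompose_multiset[of "cpoly F"] by (simp add: cpoly_simps)
  then have "cpoly (F * Q) = (\<Prod>x\<in>#proots (cpoly F). [:- x, 1:]) * smult ?l (cpoly Q)"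
    by (simp add: mult_smult_left mult_smult_right)
  from poly_length_roots_quotient[OF this, of D]
  have "cmod ?l * poly_length (cpoly Q) \<le> real (D + 1) ^ degree F * poly_length (cpoly (F * Q))"
    using assms(2) by (simp add: poly_length_smult size_proots_complex)
  moreover have "1 * poly_length (cpoly Q) \<le> cmod ?l * poly_length (cpoly Q)"
  proof (rule mult_right_mono)
    have "lead_coeff F \<noteq> 0" using assms(1) by simp
    then have "\<bar>lead_coeff F\<bar> \<ge> 1" by linarith
    then show "1 \<le> cmod ?l" by (simp flip: of_int_abs)
  qed (rule poly_length_nonneg)
  ultimately show ?thesis by simp
qed

lemma cmod_prod_mset: "cmod (\<Prod>x\<in>#M. f x) = (\<Prod>x\<in>#M. cmod (f x))"
  by (induction M) (auto simp: norm_mult)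

lemma prod_mset_mono:
  "(\<And>x. x \<in># M \<Longrightarrow> 0 \<le> f x \<and> f x \<le> g x) \<Longrightarrow> (\<Prod>x\<in>#M. f x) \<le> (\<Prod>x\<in>#M. (g x :: real)) \<and> 0 \<le> (\<Prod>x\<in>#M. f x)"
proof (induction M)
  case (add x M)
  have "0 \<le> f x" "f x \<le> g x" using add.prems by auto
  moreover have "(\<Prod>x\<in>#M. f x) \<le> (\<Prod>x\<in>#M. g x) \<and> 0 \<le> (\<Prod>x\<in>#M. f x)"
    using add.prems by (intro add.IH) auto
  ultimately show ?case by (auto intro!: mult_mono)
qed simp

text \<open>The roots in \<open>X\<close> are those at which \<open>Q\<close> is known to be small; at all others only the
  general bound is used.  Those bounds multiply to a power of the Mahler measure of \<open>f\<close>.\<close>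

lemma abs_resultant_le:
  fixes f Q :: "int poly"
  assumes "f \<noteq> 0" "Q \<noteq> 0" "X \<subseteq># proots (cpoly f)" "C \<ge> 0" "degree Q \<le> D"
    and C: "\<And>z. cmod (poly (cpoly Q) z) \<le> C * max 1 (cmod z) ^ D"
  shows "\<bar>of_int (resultant f Q)\<bar> \<le> (\<Prod>x\<in>#X. cmod (poly (cpoly Q) x)) * C ^ (degree f - size X) * exp (real D * log_mahler f)"
proof -
  define Y where "Y = proots (cpoly f) - X"
  define l where "l = \<bar>real_of_int (lead_coeff f)\<bar>"
  have XY: "proots (cpoly f) = X + Y" using assms(3) by (simp add: Y_def)
  have sY: "size Y = degree f - size X"
    using arg_cong[OF XY, of size] by (simp add: size_proots_complex)
  have l: "l \<ge> 1" using assms(1) unfolding l_def by (metis abs_ge_zero int_one_le_iff_zero_less leading_coeff_0_iff of_int_1_le_iff of_int_abs zero_less_abs_iff)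
  have "\<bar>real_of_int (resultant f Q)\<bar> = cmod (of_int (resultant f Q))" by simp
  also have "\<dots> = l ^ degree Q * ((\<Prod>x\<in>#X. cmod (poly (cpoly Q) x)) * (\<Prod>x\<in>#Y. cmod (poly (cpoly Q) x)))"
    unfolding of_int_resultant[OF assms(1,2)] XY by (simp add: norm_mult norm_power cmod_prod_mset l_def)
  also have "\<dots> \<le> l ^ D * ((\<Prod>x\<in>#X. cmod (poly (cpoly Q) x)) * (C ^ (degree f - size X) * (\<Prod>x\<in>#proots (cpoly f). max 1 (cmod x)) ^ D))"
  proof (intro mult_mono power_increasing l assms order_refl)
    have "(\<Prod>x\<in>#Y. cmod (poly (cpoly Q) x)) \<le> (\<Prod>x\<in>#Y. C * max 1 (cmod x) ^ D)"
      using C by (intro conjunct1[OF prod_mset_mono]) auto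
    also have "\<dots> = C ^ size Y * (\<Prod>x\<in>#Y. max 1 (cmod x)) ^ D"
      by (simp only: prod_mset_mult_const prod_mset_power)
    also have "\<dots> \<le> C ^ size Y * (\<Prod>x\<in>#proots (cpoly f). max 1 (cmod x)) ^ D"
    proof (intro mult_left_mono power_mono)
      have "(\<Prod>x\<in>#M. 1) \<le> (\<Prod>x\<in>#M. max 1 (cmod x))" for M
        by (intro conjunct1[OF prod_mset_mono]) auto
      then have ge1: "1 \<le> (\<Prod>x\<in>#M. max 1 (cmod x))" for M by simp
      have "1 * (\<Prod>x\<in>#Y. max 1 (cmod x)) \<le> (\<Prod>x\<in>#X. max 1 (cmod x)) * (\<Prod>x\<in>#Y. max 1 (cmod x))"
        using ge1[of Y] ge1[of X] by (intro mult_right_mono) auto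
      then show "(\<Prod>x\<in>#Y. max 1 (cmod x)) \<le> (\<Prod>x\<in>#proots (cpoly f). max 1 (cmod x))"
        by (simp add: XY)
      show "0 \<le> (\<Prod>x\<in>#Y. max 1 (cmod x))" using ge1[of Y] by simp
    qed (use assms in auto)
    finally show "(\<Prod>x\<in>#Y. cmod (poly (cpoly Q) x)) \<le> C ^ (degree f - size X) * (\<Prod>x\<in>#proots (cpoly f). max 1 (cmod x)) ^ D"
      by (simp add: sY)
    have nn: "0 \<le> (\<Prod>x\<in>#M. cmod (poly (cpoly Q) x))" for M
      by (intro conjunct2[OF prod_mset_mono]) auto
    show "0 \<le> (\<Prod>x\<in>#Y. cmod (poly (cpoly Q) x))" "0 \<le> (\<Prod>x\<in>#X. cmod (poly (cpoly Q) x))"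
      by (rule nn)+
    show "0 \<le> (\<Prod>x\<in>#X. cmod (poly (cpoly Q) x)) * (\<Prod>x\<in>#Y. cmod (poly (cpoly Q) x))"
      using nn by simp
    show "0 \<le> l ^ D" using l by simp
  qed
  also have "\<dots> = (\<Prod>x\<in>#X. cmod (poly (cpoly Q) x)) * C ^ (degree f - size X) * exp (log_mahler f) ^ D"
    unfolding exp_log_mahler[OF assms(1)] l_def by (simp add: power_mult_distrib mult_ac)
  also have "exp (log_mahler f) ^ D = exp (real D * log_mahler f)" by (simp add: exp_of_nat_mult)
  finally show ?thesis .
qed

section \<open>Lower bounds of Liouville type\<close>

lemma resultant_nonzero:
  fixes f Q :: "int poly"
  assumes "irreducible f" "\<not> f dvd Q"
  shows "resultant f Q \<noteq> 0"
proof
  assume "resultant f Q = 0"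
  then have "degree (gcd f Q) \<noteq> 0" by (simp add: resultant_0_gcd)
  then have "\<not> is_unit (gcd f Q)" by (auto simp: is_unit_poly_iff)
  then have "f dvd gcd f Q" using irreducibleD'[OF assms(1), of "gcd f Q"] by auto
  then show False using assms(2) by simp
qed

lemma abs_int_ge_1: "c \<noteq> 0 \<Longrightarrow> 1 \<le> \<bar>real_of_int c\<bar>"
  by linarith

text \<open>The resultant of \<open>f\<close> and \<open>Q\<close> is a nonzero integer, and all its factors except \<open>Q(\<kappa>)\<close> are bounded
  above.\<close>

lemma liouville:
  assumes f: "irreducible f" "poly (cpoly f) \<kappa> = 0" and Q: "poly (cpoly Q) \<kappa> \<noteq> 0" "degree Q \<le> D" and C: "C \<ge> 0"
    "\<And>z. cmod (poly (cpoly Q) z) \<le> C * max 1 (cmod z) ^ D"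
  shows "1 \<le> cmod (poly (cpoly Q) \<kappa>) * C ^ (degree f - 1) * exp (real D * log_mahler f)"
proof -
  have f0: "f \<noteq> 0" using f by auto
  have Q0: "Q \<noteq> 0" using Q by auto
  have "\<not> f dvd Q" using f(2) Q(1) by (auto simp: cpoly_simps elim!: dvdE)
  then have "1 \<le> \<bar>real_of_int (resultant f Q)\<bar>" by (intro abs_int_ge_1 resultant_nonzero f)
  also have "\<dots> \<le> (\<Prod>x\<in>#{#\<kappa>#}. cmod (poly (cpoly Q) x)) * C ^ (degree f - size {#\<kappa>#}) * exp (real D * log_mahler f)"
    using f(2) f0 by (intro abs_resultant_le f0 Q0 C Q(2)) auto
  finally show ?thesis by simp
qed

lemma cmod_poly_le_mahler:
  assumes "A \<noteq> 0"
  shows "cmod (poly (cpoly A) z) \<le> 2 ^ degree A * exp (log_mahler A) * max 1 (cmod z) ^ degree A"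
proof -
  have "cmod (poly (cpoly A) z) = \<bar>of_int (lead_coeff A)\<bar> * (\<Prod>x\<in>#proots (cpoly A). cmod (z - x))"
    by (subst poly_eq_prod_roots) (simp add: norm_mult cmod_prod_mset)
  also have "\<dots> \<le> \<bar>of_int (lead_coeff A)\<bar> * (\<Prod>x\<in>#proots (cpoly A). 2 * max 1 (cmod z) * max 1 (cmod x))"
  proof (intro mult_left_mono conjunct1[OF prod_mset_mono] conjI)
    fix x
    have "cmod (z - x) \<le> cmod z + cmod x" by (rule norm_triangle_ineq4)
    moreover have "cmod z \<le> max 1 (cmod z) * max 1 (cmod x)" using mult_mono[of "cmod z" "max 1 (cmod z)" 1 "max 1 (cmod x)"] by simp
    moreover have "cmod x \<le> max 1 (cmod z) * max 1 (cmod x)" using mult_mono[of 1 "max 1 (cmod z)" "cmod x" "max 1 (cmod x)"] by simp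
    ultimately have "cmod (z - x) \<le> 2 * (max 1 (cmod z) * max 1 (cmod x))" by linarith
    then show "cmod (z - x) \<le> 2 * max 1 (cmod z) * max 1 (cmod x)" by (simp only: mult.assoc)
  qed auto
  also have "\<dots> = 2 ^ degree A * exp (log_mahler A) * max 1 (cmod z) ^ degree A"
    unfolding prod_mset_mult_const exp_log_mahler[OF assms] by (simp add: size_proots_complex power_mult_distrib)
  finally show ?thesis .
qed

text \<open>Liouville's inequality, with the bound of \<open>A\<close> by its own Mahler measure.\<close>

lemma mean_log_dist_lower:
  assumes f: "irreducible f" "poly (cpoly f) \<kappa> = 0" and A: "A \<noteq> 0" "degree A > 0" "poly (cpoly A) \<kappa> \<noteq> 0"
  shows "- (log_mahler f + (degree f - 1) * (ln 2 + log_mahler A / degree A)) \<le> ln (cmod (poly (cpoly A) \<kappa>)) / degree A"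
proof -
  define C where "C = 2 ^ degree A * exp (log_mahler A)"
  have C0: "C > 0" by (simp add: C_def)
  have "1 \<le> cmod (poly (cpoly A) \<kappa>) * C ^ (degree f - 1) * exp (real (degree A) * log_mahler f)"
    using cmod_poly_le_mahler[OF A(1)] C0 by (intro liouville[OF f A(3) order_refl]) (auto simp: C_def)
  then have "0 \<le> ln (cmod (poly (cpoly A) \<kappa>) * C ^ (degree f - 1) * exp (real (degree A) * log_mahler f))"
    by (rule ln_ge_zero)
  also have "\<dots> = ln (cmod (poly (cpoly A) \<kappa>)) + real (degree f - 1) * ln C + real (degree A) * log_mahler f"
    using A(3) C0 by (simp add: ln_mult ln_realpow)
  also have "ln C = real (degree A) * ln 2 + log_mahler A" by (simp add: C_def ln_mult ln_realpow)
  finally have "0 \<le> (ln (cmod (poly (cpoly A) \<kappa>)) + real (degree f - 1) * (real (degree A) * ln 2 + log_mahler A) + real (degree A) * log_mahler f) / degree A"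
    by (intro divide_nonneg_nonneg) auto
  then show ?thesis using A(2) by (simp add: add_divide_distrib algebra_simps)
qed

lemma exists_power_near_1:
  fixes \<kappa> :: complex
  assumes "cmod \<kappa> = 1" "e > 0"
  shows "\<exists>n\<ge>1. cmod (\<kappa> ^ n - 1) < e"
proof -
  have "bounded (range (\<lambda>n. \<kappa> ^ n))" unfolding bounded_iff using assms(1) by (auto simp: norm_power)
  then obtain l r where lr: "strict_mono r" "((\<lambda>n. \<kappa> ^ n) \<circ> r) \<longlonglongrightarrow> l"
    using bounded_imp_convergent_subsequence by blast
  then have "Cauchy ((\<lambda>n. \<kappa> ^ n) \<circ> r)" using LIMSEQ_imp_Cauchy by blast
  then obtain M where M: "\<And>i j. i \<ge> M \<Longrightarrow> j \<ge> M \<Longrightarrow> dist (\<kappa> ^ r i) (\<kappa> ^ r j) < e"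
    using assms(2) unfolding Cauchy_def o_def by blast
  have r: "r M < r (Suc M)" using lr(1) by (simp add: strict_mono_Suc_iff)
  have "\<kappa> ^ r (Suc M) - \<kappa> ^ r M = \<kappa> ^ r M * (\<kappa> ^ (r (Suc M) - r M) - 1)"
    using r by (simp add: right_diff_distrib flip: power_add)
  then have "cmod (\<kappa> ^ r (Suc M) - \<kappa> ^ r M) = cmod (\<kappa> ^ (r (Suc M) - r M) - 1)"
    by (simp add: norm_mult norm_power assms(1))
  then have "cmod (\<kappa> ^ (r (Suc M) - r M) - 1) < e" using M[of "Suc M" M] by (simp add: dist_norm)
  then show ?thesis using r by (intro exI[of _ "r (Suc M) - r M"]) auto
qed

text \<open>A form of Kronecker's theorem.  If the Mahler measure were \<open>1\<close>, Liouville's inequality for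
  \<open>X^n - 1\<close> would give \<open>|\<kappa>^n - 1| \<ge> 2^(1-d)\<close> for all \<open>n \<ge> 1\<close>, while the powers of \<open>\<kappa>\<close> come arbitrarily close
  to \<open>1\<close>.\<close>

lemma log_mahler_pos:
  assumes f: "irreducible f" "poly (cpoly f) \<kappa> = 0" and k: "cmod \<kappa> = 1" "\<kappa> \<notin> roots_of_unity"
  shows "log_mahler f > 0"
proof (rule ccontr)
  assume "\<not> log_mahler f > 0"
  then have m: "log_mahler f = 0" using log_mahler_nonneg[of f] f by auto
  define d where "d = degree f"
  obtain n where n: "n \<ge> 1" "cmod (\<kappa> ^ n - 1) < (1 / 2) ^ d" using exists_power_near_1[OF k(1), of "(1/2)^d"] by auto
  define Q :: "int poly" where "Q = monom 1 n - 1"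
  have pQ: "poly (cpoly Q) z = z ^ n - 1" for z
    by (simp add: Q_def of_int_poly_hom.hom_minus map_poly_monom poly_monom)
  have "\<kappa> ^ n \<noteq> 1"
  proof
    assume "\<kappa> ^ n = 1"
    then have "\<kappa> \<in> roots_of_unity" unfolding roots_of_unity_def using n(1) by (intro CollectI exI[of _ n]) simp
    then show False using k(2) by simp
  qed
  then have "1 \<le> cmod (poly (cpoly Q) \<kappa>) * 2 ^ (degree f - 1) * exp (real n * log_mahler f)"
  proof (intro liouville f)
    show "degree Q \<le> n" unfolding Q_def by (intro degree_diff_le) (auto simp: degree_monom_le)
    fix z
    have "cmod (z ^ n - 1) \<le> cmod z ^ n + 1" using norm_triangle_ineq4[of "z ^ n" 1] by (simp add: norm_power)
    also have "cmod z ^ n \<le> max 1 (cmod z) ^ n" by (intro power_mono) auto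
    also have "max 1 (cmod z) ^ n + 1 \<le> 2 * max 1 (cmod z) ^ n" using one_le_power[of "max 1 (cmod z)" n] by simp
    finally show "cmod (poly (cpoly Q) z) \<le> 2 * max 1 (cmod z) ^ n" by (simp add: pQ)
  qed (auto simp: pQ)
  then have "1 \<le> cmod (\<kappa> ^ n - 1) * 2 ^ (d - 1)" by (simp add: m pQ d_def)
  also have "\<dots> \<le> cmod (\<kappa> ^ n - 1) * 2 ^ d" by (intro mult_left_mono power_increasing) auto
  also have "\<dots> < (1 / 2) ^ d * 2 ^ d" using n(2) by (intro mult_strict_right_mono) auto
  also have "\<dots> = (1::real)" by (simp flip: power_mult_distrib)
  finally show False by simp
qed

lemma poly_cpoly_cnj: "poly (cpoly P) (cnj z) = cnj (poly (cpoly P) z)"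
  by (simp add: poly_altdef coeff_map_poly)

text \<open>A real \<open>\<kappa>\<close> on the unit circle would be \<open>1\<close> or \<open>-1\<close>.\<close>

lemma unit_circle_root_cnj:
  assumes f: "irreducible f" "poly (cpoly f) \<kappa> = 0" and k: "cmod \<kappa> = 1" "\<kappa> \<notin> roots_of_unity"
  shows "{#\<kappa>, cnj \<kappa>#} \<subseteq># proots (cpoly f)" "degree f \<ge> 2"
proof -
  have ne: "\<kappa> \<noteq> cnj \<kappa>"
  proof
    assume "\<kappa> = cnj \<kappa>"
    then have "\<kappa> ^ 2 = \<kappa> * cnj \<kappa>" by (simp add: power2_eq_square)
    also have "\<dots> = 1" using complex_norm_square[of \<kappa>] k(1) by simp
    finally have "\<kappa> \<in> roots_of_unity" unfolding roots_of_unity_def by (intro CollectI exI[of _ 2]) auto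
    then show False using k(2) by simp
  qed
  have f0: "f \<noteq> 0" using f by auto
  have mem: "\<kappa> \<in># proots (cpoly f)" "cnj \<kappa> \<in># proots (cpoly f)"
    using f f0 by (auto simp: poly_cpoly_cnj)
  obtain M where M: "proots (cpoly f) = add_mset \<kappa> M" using mem(1) by (rule mset_add)
  then have "cnj \<kappa> \<in># M" using mem(2) ne by auto
  then obtain M' where "M = add_mset (cnj \<kappa>) M'" by (rule mset_add)
  then show sub: "{#\<kappa>, cnj \<kappa>#} \<subseteq># proots (cpoly f)" using M by simp
  show "degree f \<ge> 2" using size_mset_mono[OF sub] by (simp add: size_proots_complex)
qed

section \<open>Integer polynomials with a small value\<close>

text \<open>Each coordinate is rounded to one of the \<open>G + 1\<close> values \<open>0, \<dots>, G\<close>; the value \<open>G\<close> occurs only at the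
  right end of the interval.\<close>

lemma pigeonhole_box:
  fixes v :: "'a \<Rightarrow> nat \<Rightarrow> real"
  assumes "finite \<Omega>" "(G + 1) ^ N < card \<Omega>" "B > 0" "G > 0"
    and v: "\<And>c i. c \<in> \<Omega> \<Longrightarrow> i < N \<Longrightarrow> \<bar>v c i\<bar> \<le> B"
  shows "\<exists>c\<in>\<Omega>. \<exists>c'\<in>\<Omega>. c \<noteq> c' \<and> (\<forall>i<N. \<bar>v c i - v c' i\<bar> \<le> 2 * B / real G)"
proof -
  define cell where "cell = (\<lambda>c. restrict (\<lambda>i. nat \<lfloor>(v c i + B) * real G / (2 * B)\<rfloor>) {..<N})"
  have "cell c \<in> PiE {..<N} (\<lambda>_. {..G})" if "c \<in> \<Omega>" for c
  proof -
    have "nat \<lfloor>(v c i + B) * real G / (2 * B)\<rfloor> \<le> G" if "i < N" for i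
    proof -
      have "(v c i + B) * real G / (2 * B) \<le> real G"
        using v[OF \<open>c \<in> \<Omega>\<close> that] assms(3,4) by (simp add: field_simps abs_le_iff)
      then show ?thesis by linarith
    qed
    then show ?thesis by (auto simp: cell_def)
  qed
  then have "cell ` \<Omega> \<subseteq> PiE {..<N} (\<lambda>_. {..G})" by auto
  then have "card (cell ` \<Omega>) \<le> card (PiE {..<N} (\<lambda>_. {..G}))"
    by (intro card_mono finite_PiE) auto
  also have "\<dots> = (G + 1) ^ N" by (simp add: card_PiE)
  finally have "\<not> inj_on cell \<Omega>" using assms(2) card_image[of cell \<Omega>] by auto
  then obtain c c' where c: "c \<in> \<Omega>" "c' \<in> \<Omega>" "c \<noteq> c'" "cell c = cell c'" by (auto simp: inj_on_def)
  have "\<bar>v c i - v c' i\<bar> \<le> 2 * B / real G" if i: "i < N" for i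
  proof -
    have pos: "(v c i + B) * real G / (2 * B) \<ge> 0" "(v c' i + B) * real G / (2 * B) \<ge> 0"
      using v[OF c(1) i] v[OF c(2) i] assms(3) by (auto intro!: divide_nonneg_nonneg mult_nonneg_nonneg simp: abs_le_iff)
    have "nat \<lfloor>(v c i + B) * real G / (2 * B)\<rfloor> = nat \<lfloor>(v c' i + B) * real G / (2 * B)\<rfloor>"
      using fun_cong[OF c(4), of i] i by (simp add: cell_def)
    then have "\<lfloor>(v c i + B) * real G / (2 * B)\<rfloor> = \<lfloor>(v c' i + B) * real G / (2 * B)\<rfloor>"
      using pos by (metis eq_nat_nat_iff zero_le_floor)
    then have "\<bar>(v c i + B) * real G / (2 * B) - (v c' i + B) * real G / (2 * B)\<bar> \<le> 1" by linarith
    also have "(v c i + B) * real G / (2 * B) - (v c' i + B) * real G / (2 * B) = (v c i - v c' i) * (real G / (2 * B))"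
      by (simp add: algebra_simps add_divide_distrib diff_divide_distrib)
    finally have "\<bar>v c i - v c' i\<bar> * (real G / (2 * B)) \<le> 1" using assms(3) by (simp only: abs_mult) simp
    then show ?thesis using assms(3,4) by (simp add: field_simps)
  qed
  then show ?thesis using c by blast
qed

definition taylor_coeff :: "complex \<Rightarrow> nat \<Rightarrow> int poly \<Rightarrow> complex" where
  "taylor_coeff \<kappa> j P = coeff (cpoly P \<circ>\<^sub>p [:\<kappa>, 1:]) j"

lemma taylor_coeff_diff: "taylor_coeff \<kappa> j (P - Q) = taylor_coeff \<kappa> j P - taylor_coeff \<kappa> j Q"
  by (simp add: taylor_coeff_def of_int_poly_hom.hom_minus pcompose_diff)

lemma cmod_taylor_coeff_le:
  assumes "cmod \<kappa> = 1" "degree P \<le> D" "\<And>i. \<bar>coeff P i\<bar> \<le> H"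
  shows "cmod (taylor_coeff \<kappa> j P) \<le> of_int H * real (D + 1) ^ (j + 1)"
proof -
  have "cpoly P = (\<Sum>i\<le>D. smult (of_int (coeff P i)) (monom 1 i))"
    by (subst poly_as_sum_of_monoms'[of "cpoly P" D, symmetric]) (use assms(2) in \<open>auto simp: smult_monom\<close>)
  then have "cpoly P \<circ>\<^sub>p [:\<kappa>, 1:] = (\<Sum>i\<le>D. smult (of_int (coeff P i)) ([:\<kappa>, 1:] ^ i))"
    by (simp add: monom_altdef pcompose_sum pcompose_smult pcompose_hom.hom_power pcompose_pCons)
  then have "taylor_coeff \<kappa> j P = (\<Sum>i\<le>D. of_int (coeff P i) * coeff ([:\<kappa>, 1:] ^ i) j)"
    by (simp add: taylor_coeff_def coeff_sum)
  also have "cmod \<dots> \<le> (\<Sum>i\<le>D. of_int H * real (D + 1) ^ j)"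
  proof (rule order_trans[OF norm_sum], rule sum_mono)
    fix i assume i: "i \<in> {..D}"
    have H: "\<bar>real_of_int (coeff P i)\<bar> \<le> of_int H" using assms(3)[of i] by linarith
    have "cmod (coeff ([:\<kappa>, 1:] ^ i) j) \<le> real (D + 1) ^ j"
    proof (cases "j \<le> i")
      case True
      have "cmod (coeff ([:\<kappa>, 1:] ^ i) j) = real (i choose j)"
        unfolding coeff_linear_poly_power[OF True] by (simp add: norm_mult norm_power assms(1))
      also have "\<dots> \<le> real (i ^ j)" using binomial_le_pow[OF True] by (simp only: of_nat_le_iff)
      also have "\<dots> \<le> real (D + 1) ^ j" unfolding of_nat_power using i by (intro power_mono) auto
      finally show ?thesis .
    next
      case False
      have "degree ([:\<kappa>, 1:] ^ i) \<le> degree [:\<kappa>, 1:] * i" by (rule degree_power_le)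
      also have "\<dots> = i" by simp
      finally have "degree ([:\<kappa>, 1:] ^ i) < j" using False by linarith
      then have "coeff ([:\<kappa>, 1:] ^ i) j = 0" by (rule coeff_eq_0)
      then show ?thesis by simp
    qed
    then show "cmod (of_int (coeff P i) * coeff ([:\<kappa>, 1:] ^ i) j) \<le> of_int H * real (D + 1) ^ j"
      unfolding norm_mult using H by (intro mult_mono) auto
  qed
  also have "\<dots> = of_int H * real (D + 1) ^ (j + 1)" by simp
  finally show ?thesis .
qed

text \<open>The pigeonhole principle for the \<open>2T\<close> real and imaginary parts of the first \<open>T\<close> Taylor coefficients, with
  \<open>2^n\<close> choices for each of the \<open>D + 1\<close> coefficients and \<open>2^g\<close> cells in each direction.\<close>

lemma small_taylor_poly:
  assumes k: "cmod \<kappa> = 1" and g: "2 * T * g \<le> n * D" "g \<ge> 1" and n: "n \<ge> 1"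
  shows "\<exists>P. P \<noteq> 0 \<and> degree P \<le> D \<and> (\<forall>i. \<bar>coeff P i\<bar> \<le> 2 ^ n) \<and>
    (\<forall>j<T. cmod (taylor_coeff \<kappa> j P) \<le> 8 * 2 ^ n * real (D + 1) ^ (T + 1) / 2 ^ g)"
proof -
  define Pc where "Pc = (\<lambda>c :: nat \<Rightarrow> nat. \<Sum>i\<le>D. monom (int (c i)) i)"
  define \<Omega> where "\<Omega> = PiE {..D} (\<lambda>_. {..<(2::nat)^n})"
  define B where "B = 2 ^ n * real (D + 1) ^ (T + 1)"
  define v where "v = (\<lambda>c i. if even i then Re (taylor_coeff \<kappa> (i div 2) (Pc c)) else Im (taylor_coeff \<kappa> (i div 2) (Pc c)))"
  define G where "G = (2::nat) ^ g - 1"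
  have G: "G + 1 = 2 ^ g" "G > 0" using g(2) one_less_power[of "2::nat" g] by (auto simp: G_def)
  have cPc: "coeff (Pc c) i = (if i \<le> D then int (c i) else 0)" for c i
    by (simp add: Pc_def coeff_sum)
  have dPc: "degree (Pc c) \<le> D" for c by (intro degree_le) (auto simp: cPc)
  have bPc: "coeff (Pc c) i \<ge> 0 \<and> coeff (Pc c) i \<le> 2 ^ n" if "c \<in> \<Omega>" for c i
  proof (cases "i \<le> D")
    case True
    then have "c i < 2 ^ n" using that by (auto simp: \<Omega>_def PiE_def Pi_def)
    then have "int (c i) < int (2 ^ n)" by (simp only: of_nat_less_iff)
    then show ?thesis using True by (simp add: cPc)
  qed (simp add: cPc)
  have tb: "cmod (taylor_coeff \<kappa> j (Pc c)) \<le> B" if "c \<in> \<Omega>" "j < T" for c j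
  proof -
    have "cmod (taylor_coeff \<kappa> j (Pc c)) \<le> of_int (2 ^ n) * real (D + 1) ^ (j + 1)"
      using bPc[OF that(1)] by (intro cmod_taylor_coeff_le k dPc) (auto simp: abs_le_iff intro: order_trans[of _ 0])
    also have "\<dots> \<le> B" unfolding B_def using that(2) by (auto intro!: mult_mono power_increasing)
    finally show ?thesis .
  qed
  have "\<exists>c\<in>\<Omega>. \<exists>c'\<in>\<Omega>. c \<noteq> c' \<and> (\<forall>i<2 * T. \<bar>v c i - v c' i\<bar> \<le> 2 * B / real G)"
  proof (rule pigeonhole_box)
    show "finite \<Omega>" unfolding \<Omega>_def by (intro finite_PiE) auto
    have "(G + 1) ^ (2 * T) = 2 ^ (2 * T * g)" unfolding G by (simp add: mult.commute flip: power_mult)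
    also have "\<dots> < (2::nat) ^ (n * (D + 1))" using g(1) n by (intro power_strict_increasing) auto
    also have "\<dots> = card \<Omega>" unfolding \<Omega>_def by (subst card_PiE) (simp_all add: power_add flip: power_mult)
    finally show "(G + 1) ^ (2 * T) < card \<Omega>" .
    show "B > 0" by (simp add: B_def)
    fix c i assume c: "c \<in> \<Omega>" and "i < 2 * T"
    then have "i div 2 < T" by auto
    from tb[OF c this] show "\<bar>v c i\<bar> \<le> B"
      using abs_Re_le_cmod[of "taylor_coeff \<kappa> (i div 2) (Pc c)"] abs_Im_le_cmod[of "taylor_coeff \<kappa> (i div 2) (Pc c)"]
      by (auto simp: v_def)
  qed (rule G)
  then obtain c c' where c: "c \<in> \<Omega>" "c' \<in> \<Omega>" "c \<noteq> c'" "\<And>i. i < 2 * T \<Longrightarrow> \<bar>v c i - v c' i\<bar> \<le> 2 * B / real G" by blast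
  define P where "P = Pc c - Pc c'"
  have "P \<noteq> 0"
  proof
    assume "P = 0"
    then have "c i = c' i" if "i \<le> D" for i using cPc[of c i] cPc[of c' i] that by (simp add: P_def)
    then have "c = c'" using c(1,2) unfolding \<Omega>_def by (intro PiE_ext) auto
    then show False using c(3) by simp
  qed
  moreover have "degree P \<le> D" unfolding P_def by (intro degree_diff_le dPc)
  moreover have "\<bar>coeff P i\<bar> \<le> 2 ^ n" for i
    using bPc[OF c(1), of i] bPc[OF c(2), of i] by (simp add: P_def abs_le_iff)
  moreover have "cmod (taylor_coeff \<kappa> j P) \<le> 8 * 2 ^ n * real (D + 1) ^ (T + 1) / 2 ^ g" if "j < T" for j
  proof -
    have "\<bar>Re (taylor_coeff \<kappa> j P)\<bar> \<le> 2 * B / real G"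
      using c(4)[of "2 * j"] that by (simp add: v_def P_def taylor_coeff_diff)
    moreover have "\<bar>Im (taylor_coeff \<kappa> j P)\<bar> \<le> 2 * B / real G"
      using c(4)[of "2 * j + 1"] that by (simp add: v_def P_def taylor_coeff_diff)
    ultimately have "cmod (taylor_coeff \<kappa> j P) \<le> 4 * B / real G"
      using cmod_le[of "taylor_coeff \<kappa> j P"] by simp
    \<comment> \<open>\<open>G = 2^g - 1\<close> is at least half of \<open>2^g\<close>, which brings the constant from \<open>4\<close> to \<open>8\<close>.\<close>
    also have "\<dots> \<le> 4 * B / (2 ^ g / 2)"
    proof (intro divide_left_mono)
      have "(2::nat) ^ g \<le> 2 * G" using G by linarith
      then have "real (2 ^ g) \<le> real (2 * G)" by (simp only: of_nat_le_iff)
      then show "2 ^ g / 2 \<le> real G" by simp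
    qed (use G in \<open>auto simp: B_def\<close>)
    finally show ?thesis by (simp add: B_def)
  qed
  ultimately show ?thesis by blast
qed

text \<open>At \<open>\<kappa>\<close> the Taylor expansion of \<open>f\<close> starts with \<open>f'(\<kappa>)\<close> in degree \<open>1\<close>, so that of \<open>f^k Q\<close> starts in
  degree \<open>k\<close>.\<close>

lemma taylor_coeff_power_mult:
  assumes "poly (cpoly f) \<kappa> = 0"
  shows "taylor_coeff \<kappa> k (f ^ k * Q) = poly (pderiv (cpoly f)) \<kappa> ^ k * poly (cpoly Q) \<kappa>"
proof -
  define F where "F = cpoly f \<circ>\<^sub>p [:\<kappa>, 1:]"
  have "poly F 0 = 0" using assms by (simp add: F_def poly_pcompose)
  then obtain F1 where F1: "F = [:0, 1:] * F1" using poly_eq_0_iff_dvd[of F 0] by auto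
  have "pderiv F = pderiv (cpoly f) \<circ>\<^sub>p [:\<kappa>, 1:]"
    unfolding F_def pderiv_pcompose by (simp add: pderiv_pCons)
  then have "poly (pderiv F) 0 = poly (pderiv (cpoly f)) \<kappa>" by (simp add: poly_pcompose)
  moreover have "poly (pderiv F) 0 = poly F1 0" unfolding F1 by (simp add: pderiv_pCons)
  ultimately have F10: "poly F1 0 = poly (pderiv (cpoly f)) \<kappa>" by simp
  have "cpoly (f ^ k * Q) \<circ>\<^sub>p [:\<kappa>, 1:] = F ^ k * (cpoly Q \<circ>\<^sub>p [:\<kappa>, 1:])"
    by (simp add: cpoly_simps pcompose_mult pcompose_hom.hom_power F_def)
  also have "\<dots> = monom 1 k * (F1 ^ k * (cpoly Q \<circ>\<^sub>p [:\<kappa>, 1:]))"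
    unfolding F1 power_mult_distrib by (simp add: x_pow_n mult.assoc monom_altdef)
  finally have "taylor_coeff \<kappa> k (f ^ k * Q) = coeff (F1 ^ k * (cpoly Q \<circ>\<^sub>p [:\<kappa>, 1:])) 0"
    by (simp add: taylor_coeff_def coeff_monom_mult)
  also have "\<dots> = poly (F1 ^ k * (cpoly Q \<circ>\<^sub>p [:\<kappa>, 1:])) 0" by (simp add: poly_0_coeff_0)
  finally show ?thesis by (simp add: F10 poly_pcompose)
qed

text \<open>A polynomial with small Taylor coefficients is divisible by \<open>f\<close> fewer than \<open>T\<close> times, because its Mahler
  measure is smaller than that of \<open>f^T\<close>.  Removing these factors turns a small Taylor coefficient into a small
  nonzero value.\<close>

lemma exists_small_value:
  assumes f: "irreducible f" "poly (cpoly f) \<kappa> = 0" and k: "cmod \<kappa> = 1"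
    and n: "n \<ge> 1" and g: "g \<ge> 1" "2 * T * g \<le> n * D"
    and T: "real n * ln 2 + ln (real (D + 1)) < real T * log_mahler f"
    and C: "C \<ge> 1" "C \<ge> 1 / cmod (poly (pderiv (cpoly f)) \<kappa>)"
  shows "\<exists>Q. poly (cpoly Q) \<kappa> \<noteq> 0 \<and> degree Q \<le> D \<and>
    poly_length (cpoly Q) \<le> real (D + 1) ^ (degree f * T) * (real (D + 1) * 2 ^ n) \<and>
    cmod (poly (cpoly Q) \<kappa>) \<le> 8 * 2 ^ n * real (D + 1) ^ (T + 1) / 2 ^ g * C ^ T"
proof -
  define \<theta> where "\<theta> = poly (pderiv (cpoly f)) \<kappa>"
  have f0: "f \<noteq> 0" using f by auto
  have df: "degree f > 0" using degree_pos_if_root[OF f0 f(2)] .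
  have \<theta>: "\<theta> \<noteq> 0"
    using irreducible_rsquarefree[OF f(1) df] f(2) unfolding rsquarefree_roots \<theta>_def by blast
  obtain P where P: "P \<noteq> 0" "degree P \<le> D" "\<And>i. \<bar>coeff P i\<bar> \<le> 2 ^ n"
     "\<And>j. j < T \<Longrightarrow> cmod (taylor_coeff \<kappa> j P) \<le> 8 * 2 ^ n * real (D + 1) ^ (T + 1) / 2 ^ g"
    using small_taylor_poly[OF k g(2,1) n] by blast
  have lenP: "poly_length (cpoly P) \<le> real (D + 1) * 2 ^ n"
  proof -
    have "poly_length (cpoly P) = (\<Sum>i\<le>D. cmod (coeff (cpoly P) i))" using P(2) by (intro poly_length_eq) auto
    also have "\<dots> \<le> (\<Sum>i\<le>D. 2 ^ n)"
    proof (rule sum_mono)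
      fix i
      have "real_of_int \<bar>coeff P i\<bar> \<le> real_of_int (2 ^ n)" using P(3)[of i] by (simp only: of_int_le_iff)
      then show "cmod (coeff (cpoly P) i) \<le> 2 ^ n" by simp
    qed
    finally show ?thesis by simp
  qed
  have "log_mahler P \<le> ln (real (D + 1) * 2 ^ n)"
  proof (rule log_mahler_le)
    show "1 \<le> real (D + 1) * 2 ^ n" using mult_mono[of 1 "real (D + 1)" 1 "2 ^ n"] by simp
    fix z assume "cmod z = 1"
    then have "cmod (poly (cpoly P) z) \<le> poly_length (cpoly P)"
      using cmod_poly_le_length[OF order_refl, of "cpoly P" z] by simp
    then show "cmod (poly (cpoly P) z) \<le> real (D + 1) * 2 ^ n" using lenP by simp
  qed (rule P)
  also have "\<dots> = real n * ln 2 + ln (real (D + 1))" by (simp add: ln_mult ln_realpow)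
  finally have mP: "log_mahler P < real T * log_mahler f" using T by simp
  have nT: "\<not> f ^ T dvd P"
  proof
    assume "f ^ T dvd P"
    then have "log_mahler (f ^ T) \<le> log_mahler P" by (intro log_mahler_mono_dvd P)
    then show False using mP f0 by (simp add: log_mahler_power)
  qed
  have unit: "\<not> is_unit f" using f by auto
  define j where "j = multiplicity f P"
  have "f ^ j dvd P" unfolding j_def by (rule multiplicity_dvd)
  then obtain Q where Q: "P = f ^ j * Q" by (rule dvdE)
  have jT: "j < T"
  proof (rule ccontr)
    assume "\<not> j < T"
    then have "f ^ T dvd f ^ j" by (intro le_imp_power_dvd) simp
    then show False using nT \<open>f ^ j dvd P\<close> dvd_trans by blast
  qed
  have "\<not> f ^ Suc j dvd P" unfolding j_def using P(1) unit power_dvd_iff_le_multiplicity[of P f]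
    by (simp del: power_Suc)
  moreover have "f ^ Suc j dvd P" if "f dvd Q"
    using mult_dvd_mono[OF dvd_refl[of "f ^ j"] that] unfolding Q by (simp add: mult.commute)
  ultimately have "\<not> f dvd Q" by blast
  then have Qk: "poly (cpoly Q) \<kappa> \<noteq> 0" using irreducible_dvd_if_root[OF f] by blast
  have Q0: "Q \<noteq> 0" using P(1) Q by auto
  have "degree P = degree (f ^ j) + degree Q" unfolding Q using Q0 f0 by (intro degree_mult_eq) auto
  then have dQ: "degree Q \<le> D" using P(2) by simp
  have "poly_length (cpoly Q) \<le> real (D + 1) ^ degree (f ^ j) * poly_length (cpoly P)"
    unfolding Q using f0 P(2) by (intro poly_length_int_quotient) (auto simp flip: Q)
  also have "\<dots> \<le> real (D + 1) ^ (degree f * T) * (real (D + 1) * 2 ^ n)"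
  proof (intro mult_mono power_increasing lenP poly_length_nonneg)
    show "degree (f ^ j) \<le> degree f * T" using jT by (simp add: degree_power_eq f0 mult.commute)
  qed auto
  finally have lQ: "poly_length (cpoly Q) \<le> real (D + 1) ^ (degree f * T) * (real (D + 1) * 2 ^ n)" .
  have "taylor_coeff \<kappa> j P = \<theta> ^ j * poly (cpoly Q) \<kappa>"
    unfolding Q \<theta>_def by (rule taylor_coeff_power_mult[OF f(2)])
  then have "cmod (poly (cpoly Q) \<kappa>) = cmod (taylor_coeff \<kappa> j P) * (1 / cmod \<theta>) ^ j"
    using \<theta> by (simp add: norm_mult norm_power power_divide)
  also have "\<dots> \<le> 8 * 2 ^ n * real (D + 1) ^ (T + 1) / 2 ^ g * C ^ T"
  proof (intro mult_mono P(4) jT)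
    have "(1 / cmod \<theta>) ^ j \<le> C ^ j" using C(2) by (intro power_mono) (auto simp: \<theta>_def)
    also have "\<dots> \<le> C ^ T" using C(1) jT by (intro power_increasing) auto
    finally show "(1 / cmod \<theta>) ^ j \<le> C ^ T" .
  qed auto
  finally show ?thesis using Qk dQ lQ by blast
qed

section \<open>Making all factors large\<close>

text \<open>Put \<open>W = f U + Q\<close>.  Modulo \<open>p\<close> the roots of \<open>A\<close> are roots of \<open>f\<close>, and there \<open>W\<close> agrees with \<open>Q\<close>, which
  does not vanish; so \<open>p\<close> does not divide the norm of \<open>W(\<alpha>)\<close> for a root \<open>\<alpha>\<close> of \<open>A\<close>.  On the other hand
  \<open>f(\<alpha>)^K = -p W(\<alpha>)\<close>, so the \<open>K\<close>-th power of the norm of \<open>f(\<alpha>)\<close> is divisible by \<open>p\<close> exactly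
  \<open>deg A\<close> times, and \<open>deg A\<close> must be a multiple of \<open>K\<close>.  Resultants stand in for the norms; they differ from
  them by powers of the leading coefficient of \<open>A\<close>, which is prime to \<open>p\<close>.\<close>

lemma degree_factor_ge_exponent:
  fixes f Q U A B :: "int poly" and p :: int
  assumes p: "prime p" and lc: "\<not> p dvd lead_coeff f" and df: "degree f > 0" and K: "K > 0"
    and eq: "A * B = f ^ K + smult p (f * U + Q)" and deg: "degree (A * B) = K * degree f"
    and res: "\<not> p dvd resultant f Q" and dA: "degree A > 0" and lcA: "\<not> p dvd lead_coeff A"
  shows "K \<le> degree A"
proof (rule ccontr)
  assume "\<not> K \<le> degree A"
  define W where "W = f * U + Q"
  define e where "e = degree A"
  have e: "e < K" "e > 0" using \<open>\<not> K \<le> degree A\<close> dA by (auto simp: e_def)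
  have f0: "f \<noteq> 0" using df by auto
  have A0: "A \<noteq> 0" using dA by auto
  have AB0: "A * B \<noteq> 0" using deg df K by (metis degree_0 mult_pos_pos less_numeral_extra(3))
  have B0: "B \<noteq> 0" using AB0 by auto
  have Q0: "Q \<noteq> 0" using res df by auto
  have W0: "W \<noteq> 0"
  proof
    assume "W = 0"
    then have "Q = f * (- U)" by (simp add: W_def add_eq_0_iff2)
    then have "f dvd Q" by simp
    then show False using resultant_eq_0_if_dvd[OF f0 Q0 df] res by simp
  qed
  have eqW: "A * B = f ^ K + smult p W" using eq by (simp add: W_def)
  have "complex_of_int (lead_coeff f ^ degree Q * resultant f W) = of_int (lead_coeff f ^ degree W * resultant f Q)"
  proof -
    have "image_mset (poly (cpoly W)) (proots (cpoly f)) = image_mset (poly (cpoly Q)) (proots (cpoly f))"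
      by (intro image_mset_cong) (auto simp: W_def cpoly_simps proots_cpoly_root)
    then show ?thesis using f0 W0 Q0 by (simp add: of_int_resultant)
  qed
  then have "lead_coeff f ^ degree Q * resultant f W = lead_coeff f ^ degree W * resultant f Q"
    by (simp only: of_int_eq_iff)
  then have pW: "\<not> p dvd resultant f W"
    using p lc res by (metis dvd_mult prime_dvd_mult_iff prime_dvd_power)
  \<comment> \<open>Modulo \<open>p\<close> the resultant of \<open>W\<close> and \<open>A\<close> divides that of \<open>W\<close> and \<open>f^K\<close>.\<close>
  have "[resultant W (A * B) = resultant W (f ^ K)] (mod p)"
  proof (rule resultant_cong_right)
    show "degree (A * B) = degree (f ^ K)" using deg by (simp add: degree_power_eq f0)
    show "[coeff (A * B) i = coeff (f ^ K) i] (mod p)" for i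
      by (simp add: eqW cong_iff_dvd_diff)
  qed
  then have "[resultant W A * resultant W B = resultant W f ^ K] (mod p)"
    by (simp add: resultant_mult_right resultant_power_right W0 A0 B0 f0)
  moreover have "\<not> p dvd resultant W f ^ K"
  proof
    assume "p dvd resultant W f ^ K"
    then have "p dvd resultant W f" using p prime_dvd_power by blast
    then show False using pW resultant_swap[of f W] by simp
  qed
  ultimately have "\<not> p dvd resultant W A"
    by (metis cong_dvd_iff dvd_mult2)
  then have pA: "\<not> p dvd resultant A W"
    using resultant_swap[of W A] by auto
  \<comment> \<open>Multiplying \<open>f(\<alpha>)^K = -p W(\<alpha>)\<close> over the roots and clearing leading coefficients compares the powers
    of \<open>p\<close>: the left-hand side is divisible by \<open>p^K\<close>, while only \<open>p^e\<close> with \<open>e < K\<close> is visible on the right, so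
    \<open>p\<close> divides the resultant of \<open>A\<close> and \<open>W\<close>.\<close>
  have img: "poly (cpoly f) x ^ K = - of_int p * poly (cpoly W) x" if "x \<in># proots (cpoly A)" for x
  proof -
    have "poly (cpoly (A * B)) x = 0" using proots_cpoly_root[OF that] by (simp add: cpoly_simps)
    then show ?thesis unfolding eqW by (simp add: cpoly_simps add_eq_0_iff2)
  qed
  have "(\<Prod>x\<in>#proots (cpoly A). poly (cpoly f) x ^ K) = (\<Prod>x\<in>#proots (cpoly A). - of_int p * poly (cpoly W) x)"
    by (intro arg_cong[of _ _ prod_mset] image_mset_cong img)
  then have img': "(\<Prod>x\<in>#proots (cpoly A). poly (cpoly f) x) ^ K = (- of_int p) ^ e * (\<Prod>x\<in>#proots (cpoly A). poly (cpoly W) x)"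
    unfolding prod_mset_mult_const prod_mset_power by (simp add: size_proots_complex e_def)
  have "complex_of_int (lead_coeff A ^ degree W * resultant A f ^ K)
     = of_int (lead_coeff A ^ (K * degree f) * ((- p) ^ e * resultant A W))"
    unfolding of_int_mult of_int_power of_int_resultant[OF A0 f0] of_int_resultant[OF A0 W0]
      power_mult_distrib img' by (simp add: mult_ac flip: power_mult)
  then have main: "lead_coeff A ^ degree W * resultant A f ^ K = lead_coeff A ^ (K * degree f) * ((- p) ^ e * resultant A W)"
    by (simp only: of_int_eq_iff)
  have cop: "coprime (p ^ j) (lead_coeff A ^ i)" for i j
    using p lcA by (simp add: prime_imp_coprime)
  have "p dvd lead_coeff A ^ degree W * resultant A f ^ K"
  proof -
    have "- p dvd (- p) ^ e" using e by (intro dvd_power) auto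
    then have "p dvd (- p) ^ e" by simp
    then show ?thesis unfolding main by (metis dvd_mult dvd_mult2)
  qed
  then have "p dvd resultant A f ^ K"
    using cop[of 1 "degree W"] by (simp add: coprime_dvd_mult_right_iff)
  then have "p dvd resultant A f" using p prime_dvd_power by blast
  then have "p ^ K dvd lead_coeff A ^ (K * degree f) * ((- p) ^ e * resultant A W)"
    unfolding main[symmetric] by (intro dvd_mult dvd_power_same)
  then have "p ^ K dvd (- p) ^ e * resultant A W"
    using cop[of K "K * degree f"] by (simp add: coprime_dvd_mult_right_iff)
  then have "p ^ e * p ^ (K - e) dvd p ^ e * resultant A W"
    using e by (cases "even e") (auto simp flip: power_add)
  then have "p ^ (K - e) dvd resultant A W" using p by simp
  moreover have "p dvd p ^ (K - e)" using e by (simp add: dvd_power)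
  ultimately show False using pA dvd_trans by blast
qed

text \<open>The quantity \<open>log |P(\<kappa>)| - log |lc(P)| - s deg P\<close> is additive over factors and vanishes on constants; if
  it is at most \<open>0\<close> for \<open>P\<close>, it cannot be positive on every nonconstant irreducible factor.\<close>

lemma exists_irreducible_factor_below:
  fixes P :: "int poly" and s :: real
  assumes "P \<noteq> 0" "degree P > 0" "poly (cpoly P) \<kappa> \<noteq> 0"
    "ln (cmod (poly (cpoly P) \<kappa>)) - ln \<bar>of_int (lead_coeff P)\<bar> \<le> s * degree P"
  shows "\<exists>A. irreducible A \<and> lead_coeff A \<ge> 1 \<and> degree A > 0 \<and> A dvd P \<and> poly (cpoly A) \<kappa> \<noteq> 0 \<and>
    ln (cmod (poly (cpoly A) \<kappa>)) - ln \<bar>of_int (lead_coeff A)\<bar> \<le> s * degree A"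
  using assms
proof (induction P rule: prime_divisors_induct)
  case (unit P)
  then show ?case by (auto simp: is_unit_poly_iff)
next
  case (factor p P)
  define w where "w = (\<lambda>P::int poly. ln (cmod (poly (cpoly P) \<kappa>)) - ln \<bar>of_int (lead_coeff P)\<bar> - s * degree P)"
  have p: "irreducible p" using factor.hyps by (intro prime_elem_imp_irreducible prime_imp_prime_elem)
  have nz: "p \<noteq> 0" "P \<noteq> 0" "poly (cpoly p) \<kappa> \<noteq> 0" "poly (cpoly P) \<kappa> \<noteq> 0"
    using factor.prems by (auto simp: cpoly_simps)
  have lc: "lead_coeff p \<ge> 1" using factor.hyps by (intro lead_coeff_prime_int_poly)
  have const: "w R = 0" if R: "degree R = 0" "R \<noteq> 0" for R :: "int poly"
  proof -
    obtain c where "R = [:c:]" using R(1) by (rule degree_eq_zeroE)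
    then show ?thesis by (simp add: w_def of_int_hom.map_poly_pCons_hom)
  qed
  have "w (p * P) = w p + w P"
    unfolding w_def unfolding lead_coeff_mult unfolding degree_mult_eq[OF nz(1,2)]
    using nz by (simp add: cpoly_simps norm_mult ln_mult abs_mult algebra_simps)
  then have sum: "w p + w P \<le> 0" using factor.prems(4) by (simp add: w_def)
  show ?case
  proof (cases "degree p > 0 \<and> w p \<le> 0")
    case True
    then show ?thesis using p nz lc by (intro exI[of _ p]) (simp add: w_def)
  next
    case False
    have "degree P > 0 \<and> w P \<le> 0"
    proof (cases "degree p = 0")
      case True
      then have "w p = 0" using const nz by blast
      moreover have "degree P > 0" using factor.prems(2) True nz by (simp add: degree_mult_eq)
      ultimately show ?thesis using sum by simp
    next
      case F: False
      then have "w P < 0" using False sum by auto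
      moreover have "degree P \<noteq> 0" using const[of P] nz(2) \<open>w P < 0\<close> by auto
      ultimately show ?thesis by simp
    qed
    then obtain A where "irreducible A \<and> lead_coeff A \<ge> 1 \<and> degree A > 0 \<and> A dvd P \<and> poly (cpoly A) \<kappa> \<noteq> 0 \<and>
      ln (cmod (poly (cpoly A) \<kappa>)) - ln \<bar>of_int (lead_coeff A)\<bar> \<le> s * degree A"
      using factor.IH nz by (auto simp: w_def)
    then show ?thesis using dvd_mult[of A P p] by blast
  qed
qed auto

text \<open>Euclid's argument: a prime factor of \<open>|a| + 1\<close>.\<close>

lemma exists_prime_not_dvd:
  fixes a :: int
  assumes "a \<noteq> 0"
  shows "\<exists>p. prime p \<and> \<not> p dvd a \<and> p \<le> \<bar>a\<bar> + 1"
proof -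
  have "\<not> is_unit (\<bar>a\<bar> + 1)" using assms by auto
  moreover have "\<bar>a\<bar> + 1 \<noteq> 0" by linarith
  ultimately obtain p where p: "prime p" "p dvd \<bar>a\<bar> + 1"
    using prime_divisor_exists[of "\<bar>a\<bar> + 1"] by blast
  have "\<not> p dvd a"
  proof
    assume "p dvd a"
    then have "p dvd (\<bar>a\<bar> + 1) - \<bar>a\<bar>" using p(2) by (intro dvd_diff) auto
    then have "is_unit p" by simp
    then show False using p(1) not_prime_unit by blast
  qed
  moreover have "p \<le> \<bar>a\<bar> + 1" using p by (intro zdvd_imp_le) auto
  ultimately show ?thesis using p by blast
qed

text \<open>The polynomial \<open>f S + p Q\<close> described at the beginning.  The number \<open>R\<close> bounds the resultant of \<open>f\<close>
  and \<open>Q\<close>, and \<open>b\<close> bounds the prime \<open>p\<close>; when \<open>\<epsilon>\<close> is of size \<open>exp(-D m(f)/2)\<close>, the square in \<open>R\<close> cancels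
  the exponential.\<close>

lemma exists_irreducible_small_value:
  assumes f: "irreducible f" "poly (cpoly f) \<kappa> = 0" "lead_coeff f \<ge> 1" and k: "cmod \<kappa> = 1" "\<kappa> \<notin> roots_of_unity"
    and Q: "poly (cpoly Q) \<kappa> \<noteq> 0" "degree Q \<le> D" "poly_length (cpoly Q) \<le> L" "cmod (poly (cpoly Q) \<kappa>) \<le> \<epsilon>"
    and d: "d = degree f" and K: "K = D div d + 1"
    and R: "R = \<epsilon>\<^sup>2 * L ^ (d - 2) * exp (real D * log_mahler f)"
    and b: "b = of_int (lead_coeff f) * R + 1"
  shows "\<exists>A. irreducible A \<and> lead_coeff A \<ge> 1 \<and> poly (cpoly A) \<kappa> \<noteq> 0 \<and> K \<le> degree A \<and> R \<ge> 1 \<and>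
    log_mahler A \<le> ln (b * (poly_length (cpoly f) * (K * d) + L)) \<and>
    ln (cmod (poly (cpoly A) \<kappa>)) - ln (of_int (lead_coeff A)) \<le> ln (b * \<epsilon>) / (K * d) * degree A"
proof -
  define a where "a = lead_coeff f"
  have f0: "f \<noteq> 0" using f by auto
  have Q0: "Q \<noteq> 0" using Q by auto
  have d2: "d \<ge> 2" using unit_circle_root_cnj(2)[OF f(1,2) k] d by simp
  have nd: "\<not> f dvd Q" using f(2) Q(1) by (auto simp: cpoly_simps elim!: dvdE)
  define \<rho> where "\<rho> = resultant f Q"
  have \<rho>0: "\<rho> \<noteq> 0" unfolding \<rho>_def by (rule resultant_nonzero[OF f(1) nd])
  have L0: "L \<ge> 0" using Q(3) poly_length_nonneg order_trans by blast
  have \<epsilon>0: "\<epsilon> > 0" using Q(1,4) by (meson less_le_trans zero_less_norm_iff)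
  have \<rho>le: "\<bar>real_of_int \<rho>\<bar> \<le> R"
  proof -
    have "\<bar>real_of_int \<rho>\<bar> \<le> (\<Prod>x\<in>#{#\<kappa>, cnj \<kappa>#}. cmod (poly (cpoly Q) x)) * L ^ (degree f - size {#\<kappa>, cnj \<kappa>#}) * exp (real D * log_mahler f)"
      unfolding \<rho>_def
    proof (intro abs_resultant_le f0 Q0 unit_circle_root_cnj(1)[OF f(1,2) k] L0 Q(2))
      fix z
      have "cmod (poly (cpoly Q) z) \<le> poly_length (cpoly Q) * max 1 (cmod z) ^ D"
        using Q(2) by (intro cmod_poly_le_length) simp
      also have "\<dots> \<le> L * max 1 (cmod z) ^ D" using Q(3) by (intro mult_right_mono) auto
      finally show "cmod (poly (cpoly Q) z) \<le> L * max 1 (cmod z) ^ D" .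
    qed
    also have "\<dots> = (cmod (poly (cpoly Q) \<kappa>))\<^sup>2 * L ^ (d - 2) * exp (real D * log_mahler f)"
      by (simp add: poly_cpoly_cnj d power2_eq_square numeral_2_eq_2)
    also have "\<dots> \<le> R" unfolding R using Q(4) L0 by (intro mult_right_mono power_mono) auto
    finally show ?thesis .
  qed
  have R1: "R \<ge> 1" using \<rho>le abs_int_ge_1[OF \<rho>0] by simp
  have a1: "a \<ge> 1" using f(3) by (simp add: a_def)
  obtain p where p: "prime p" "\<not> p dvd a * \<rho>" "p \<le> \<bar>a * \<rho>\<bar> + 1"
    using exists_prime_not_dvd[of "a * \<rho>"] \<rho>0 a1 by auto
  have pa: "\<not> p dvd a" and p\<rho>: "\<not> p dvd \<rho>" using p(2) by auto
  have p2: "p \<ge> 2" using p(1) prime_ge_2_int by blast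
  have pb: "real_of_int p \<le> b"
  proof -
    have "real_of_int p \<le> of_int (\<bar>a * \<rho>\<bar> + 1)" using p(3) by (simp only: of_int_le_iff)
    also have "\<dots> = of_int a * \<bar>real_of_int \<rho>\<bar> + 1" using a1 by (simp add: abs_mult)
    also have "\<dots> \<le> b" unfolding b a_def[symmetric] using \<rho>le a1 by (intro add_right_mono mult_left_mono) auto
    finally show ?thesis .
  qed
  \<comment> \<open>The leading coefficient of \<open>f^(K-1)\<close> survives the reduction modulo \<open>p\<close>, so \<open>f S\<close> has degree \<open>K d > D\<close>
    and dominates \<open>p Q\<close>.\<close>
  have K1: "K \<ge> 1" using K by simp
  have KD: "D < K * d" using d2 unfolding K by (metis Suc_eq_plus1 dividend_less_div_times mult.commute mult_Suc_right add.commute zero_less_numeral less_le_trans pos2)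
  define F where "F = f ^ (K - 1)"
  define S where "S = map_poly (\<lambda>c. c mod p) F"
  define U where "U = map_poly (\<lambda>c. c div p) F"
  have FSU: "F = S + smult p U"
    by (intro poly_eqI) (simp add: S_def U_def coeff_map_poly)
  have dF: "degree F = (K - 1) * d" unfolding F_def d by (simp add: degree_power_eq f0)
  have lF: "lead_coeff F = a ^ (K - 1)" unfolding F_def a_def by (rule lead_coeff_power)
  have lS: "\<not> p dvd coeff S (degree F)"
  proof -
    have "\<not> p dvd lead_coeff F" unfolding lF using pa p(1) prime_dvd_power by blast
    then show ?thesis by (simp add: S_def coeff_map_poly dvd_mod_iff)
  qed
  have dS: "degree S = (K - 1) * d"
  proof (rule antisym)
    show "degree S \<le> (K - 1) * d" unfolding dF[symmetric] S_def by (intro degree_map_poly_le)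
    have "coeff S (degree F) \<noteq> 0" using lS by auto
    then show "(K - 1) * d \<le> degree S" unfolding dF[symmetric] by (rule le_degree)
  qed
  have S0: "S \<noteq> 0" using lS by auto
  have dfS: "degree (f * S) = K * d"
    using f0 S0 K1 by (simp add: degree_mult_eq dS d[symmetric] mult_eq_if)
  define P where "P = f * S + smult p Q"
  have dlt: "degree (smult p Q) < degree (f * S)" unfolding dfS using KD Q(2) p2 by simp
  have dP: "degree P = K * d" unfolding P_def using dlt dfS by (simp add: degree_add_eq_left)
  have lP: "\<not> p dvd lead_coeff P"
  proof -
    have "lead_coeff P = lead_coeff (f * S)" unfolding P_def using lead_coeff_add_le dlt
      by (metis add.commute lead_coeff_add_le)
    also have "\<dots> = a * lead_coeff S" by (simp add: lead_coeff_mult a_def)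
    finally show ?thesis using pa lS p(1) by (simp add: dS dF prime_dvd_mult_iff)
  qed
  have P0: "P \<noteq> 0" using lP by auto
  have Pk: "poly (cpoly P) \<kappa> = of_int p * poly (cpoly Q) \<kappa>"
    by (simp add: P_def cpoly_simps f(2))
  have Peq: "P = f ^ K + smult p (f * (- U) + Q)"
  proof -
    have "f ^ K = f * F" using K1 by (simp add: F_def power_eq_if)
    then show ?thesis unfolding P_def FSU by (simp add: algebra_simps smult_add_right smult_diff_right)
  qed
  have Kd0: "real (K * d) > 0" using K1 d2 by simp
  have b1: "b > 0" using pb p2 by linarith
  have lnP: "ln (cmod (poly (cpoly P) \<kappa>)) - ln \<bar>of_int (lead_coeff P)\<bar> \<le> ln (b * \<epsilon>) / (K * d) * degree P"
  proof -
    have "cmod (poly (cpoly P) \<kappa>) = of_int p * cmod (poly (cpoly Q) \<kappa>)" using p2 by (simp add: Pk norm_mult)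
    also have "\<dots> \<le> b * \<epsilon>" using pb Q(4) b1 by (intro mult_mono) auto
    finally have "ln (cmod (poly (cpoly P) \<kappa>)) \<le> ln (b * \<epsilon>)" using Pk Q(1) p2 by (intro ln_mono) auto
    moreover have "0 \<le> ln \<bar>real_of_int (lead_coeff P)\<bar>" using P0 by (intro ln_abs_int_nonneg) simp
    moreover have "ln (b * \<epsilon>) / (K * d) * degree P = ln (b * \<epsilon>)" using K1 d2 unfolding dP by simp
    ultimately show ?thesis by linarith
  qed
  have "poly (cpoly P) \<kappa> \<noteq> 0" "degree P > 0" using Pk Q(1) p2 dP K1 d2 by auto
  from exists_irreducible_factor_below[OF P0 this(2,1) lnP]
  obtain A where A: "irreducible A" "lead_coeff A \<ge> 1" "degree A > 0" "A dvd P" "poly (cpoly A) \<kappa> \<noteq> 0"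
    "ln (cmod (poly (cpoly A) \<kappa>)) - ln \<bar>of_int (lead_coeff A)\<bar> \<le> ln (b * \<epsilon>) / (K * d) * degree A" by blast
  obtain B where B: "P = A * B" using A(4) by (rule dvdE)
  have "K \<le> degree A"
  proof (rule degree_factor_ge_exponent[OF p(1)])
    show "\<not> p dvd lead_coeff f" using pa by (simp add: a_def)
    show "0 < degree f" using d2 d by simp
    show "0 < K" using K1 by simp
    show "A * B = f ^ K + smult p (f * (- U) + Q)" using Peq B by simp
    show "degree (A * B) = K * degree f" using dP B d by simp
    show "\<not> p dvd resultant f Q" using p\<rho> by (simp add: \<rho>_def)
    show "0 < degree A" by (rule A)
    show "\<not> p dvd lead_coeff A" using lP unfolding B lead_coeff_mult by auto
  qed
  moreover have "log_mahler A \<le> ln (b * (poly_length (cpoly f) * (K * d) + L))"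
  proof -
    have "log_mahler A \<le> log_mahler P" by (intro log_mahler_mono_dvd A P0)
    also have "\<dots> \<le> ln (b * (poly_length (cpoly f) * (K * d) + L))"
    proof (rule log_mahler_le[OF P0])
      have lenS: "poly_length (cpoly S) \<le> of_int p * real (K * d)"
      proof -
        have "poly_length (cpoly S) = (\<Sum>i\<le>(K - 1) * d. cmod (coeff (cpoly S) i))"
          by (intro poly_length_eq) (simp add: dS)
        also have "\<dots> \<le> (\<Sum>i\<le>(K - 1) * d. of_int p)"
          using p2 by (intro sum_mono) (simp add: S_def coeff_map_poly less_imp_le)
        also have "\<dots> = of_int p * real ((K - 1) * d + 1)" by simp
        also have "(K - 1) * d + 1 \<le> K * d" using K1 d2 by (cases K) auto
        then have "of_int p * real ((K - 1) * d + 1) \<le> of_int p * real (K * d)"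
          using p2 by (intro mult_left_mono) (auto simp del: of_nat_mult of_nat_add)
        finally show ?thesis .
      qed
      have bound: "cmod (poly (cpoly P) z) \<le> of_int p * (poly_length (cpoly f) * (K * d) + L)" if "cmod z = 1" for z
      proof -
        have le: "cmod (poly r z) \<le> poly_length r" for r
          using cmod_poly_le_length[OF order_refl, of r z] that by simp
        have "cmod (poly (cpoly P) z) \<le> cmod (poly (cpoly f) z) * cmod (poly (cpoly S) z) + of_int p * cmod (poly (cpoly Q) z)"
          using norm_triangle_ineq[of "poly (cpoly f) z * poly (cpoly S) z" "of_int p * poly (cpoly Q) z"] p2
          by (simp add: P_def cpoly_simps norm_mult)
        also have "\<dots> \<le> poly_length (cpoly f) * (of_int p * real (K * d)) + of_int p * L"
          using p2 le[of "cpoly f"] order_trans[OF le lenS] order_trans[OF le Q(3)] poly_length_nonneg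
          by (intro add_mono mult_mono) auto
        finally show ?thesis by (simp add: algebra_simps)
      qed
      have nn: "0 \<le> poly_length (cpoly f) * (K * d) + L" using L0 poly_length_nonneg by (intro add_nonneg_nonneg mult_nonneg_nonneg) auto
      have pb': "of_int p * (poly_length (cpoly f) * (K * d) + L) \<le> b * (poly_length (cpoly f) * (K * d) + L)"
        using pb nn by (intro mult_right_mono)
      show "cmod (poly (cpoly P) z) \<le> b * (poly_length (cpoly f) * (K * d) + L)" if "cmod z = 1" for z
        using bound[OF that] pb' by simp
      have "1 \<le> poly_length (cpoly f)"
      proof -
        have "1 \<le> cmod (coeff (cpoly f) (degree f))" using f(3) by simp
        also have "\<dots> \<le> poly_length (cpoly f)" unfolding poly_length_def by (intro member_le_sum) auto
        finally show ?thesis .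
      qed
      moreover have "1 \<le> real (K * d)"
      proof -
        have "1 \<le> K * d" using KD by linarith
        then show ?thesis by (metis of_nat_1 of_nat_le_iff)
      qed
      ultimately have "1 * 1 \<le> poly_length (cpoly f) * (K * d)" by (intro mult_mono) auto
      then have "1 * 1 \<le> b * (poly_length (cpoly f) * (K * d) + L)"
        using pb p2 L0 by (intro mult_mono) auto
      then show "1 \<le> b * (poly_length (cpoly f) * (K * d) + L)" by simp
    qed
    finally show ?thesis .
  qed
  ultimately show ?thesis using A R1 by (intro exI[of _ A]) (simp add: abs_of_pos)
qed

section \<open>The limit\<close>

text \<open>Asymptotics of the construction with \<open>D = n^3\<close>.  The exponent \<open>3\<close> only serves to make every error
  term, such as \<open>T log D\<close> with \<open>T\<close> of order \<open>n\<close>, negligible against \<open>D\<close>.  The main terms are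
  \<open>T/n \<longrightarrow> log 2 / m(f)\<close> and \<open>g log 2 / D \<longrightarrow> m(f)/2\<close>.\<close>

lemma exists_irreducible_small_height_and_value:
  fixes e :: real
  assumes f: "irreducible f" "poly (cpoly f) \<kappa> = 0" "lead_coeff f \<ge> 1" and k: "cmod \<kappa> = 1" "\<kappa> \<notin> roots_of_unity"
    and e: "e > 0"
  shows "\<exists>A. irreducible A \<and> lead_coeff A \<ge> 1 \<and> poly (cpoly A) \<kappa> \<noteq> 0 \<and> N \<le> degree A \<and>
    log_mahler A \<le> e * degree A \<and>
    ln (cmod (poly (cpoly A) \<kappa>)) - ln (of_int (lead_coeff A)) \<le> (e - log_mahler f / 2) * degree A"
proof -
  define m where "m = log_mahler f"
  define d where "d = degree f"
  define a where "a = real_of_int (lead_coeff f)"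
  define len where "len = poly_length (cpoly f)"
  have m: "m > 0" unfolding m_def by (rule log_mahler_pos[OF f(1,2) k])
  have d2: "d \<ge> 2" using unit_circle_root_cnj(2)[OF f(1,2) k] by (simp add: d_def)
  have a1: "a \<ge> 1" using f(3) by (simp add: a_def)
  have len0: "len \<ge> 0" unfolding len_def by (rule poly_length_nonneg)
  define C where "C = max 1 (1 / cmod (poly (pderiv (cpoly f)) \<kappa>))"
  have C: "C \<ge> 1" "C \<ge> 1 / cmod (poly (pderiv (cpoly f)) \<kappa>)" by (auto simp: C_def)
  define x where "x = (\<lambda>n::nat. (real n * ln 2 + ln (real n ^ 3 + 1)) / m)"
  define T where "T = (\<lambda>n. nat \<lceil>x n\<rceil> + 1)"
  define g where "g = (\<lambda>n. (n * n ^ 3) div (2 * T n))"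
  define K where "K = (\<lambda>n::nat. n ^ 3 div d + 1)"
  define L where "L = (\<lambda>n. real (n ^ 3 + 1) ^ (d * T n) * (real (n ^ 3 + 1) * 2 ^ n))"
  define \<epsilon> where "\<epsilon> = (\<lambda>n. 8 * 2 ^ n * real (n ^ 3 + 1) ^ (T n + 1) / 2 ^ g n * C ^ T n)"
  define R where "R = (\<lambda>n. (\<epsilon> n)\<^sup>2 * L n ^ (d - 2) * exp (real (n ^ 3) * m))"
  define lL where "lL = (\<lambda>n. real d * real (T n) * ln (real n ^ 3 + 1) + (ln (real n ^ 3 + 1) + real n * ln 2))"
  define l\<epsilon> where "l\<epsilon> = (\<lambda>n. ln 8 + real n * ln 2 + (real (T n) + 1) * ln (real n ^ 3 + 1) - real (g n) * ln 2 + real (T n) * ln C)"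
  define lR where "lR = (\<lambda>n. 2 * l\<epsilon> n + real (d - 2) * lL n + real n ^ 3 * m)"
  define E1 where "E1 = (\<lambda>n. ln (2 * a) + lR n + (ln (len * (real n ^ 3 + real d) + 1) + lL n))"
  define E2 where "E2 = (\<lambda>n. ln (2 * a) + lR n + l\<epsilon> n)"
  have L1: "L n \<ge> 1" for n
    unfolding L_def using mult_mono[of 1 "real (n ^ 3 + 1) ^ (d * T n)" 1 "real (n ^ 3 + 1) * 2 ^ n"]
      mult_mono[of 1 "real (n ^ 3 + 1)" 1 "2 ^ n"] by (auto intro: one_le_power)
  have \<epsilon>0: "\<epsilon> n > 0" for n unfolding \<epsilon>_def using C(1) by (intro mult_pos_pos divide_pos_pos) (auto simp: add_pos_nonneg)
  have R0: "R n > 0" for n using \<epsilon>0[of n] L1[of n] by (simp add: R_def)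
  have D1: "real n ^ 3 + 1 > 0" for n :: nat by (simp add: add_nonneg_pos)
  have lnL: "ln (L n) = lL n" for n
    using D1[of n] by (simp add: L_def lL_def ln_mult ln_realpow add.commute)
  have ln\<epsilon>: "ln (\<epsilon> n) = l\<epsilon> n" for n
  proof -
    have "ln (8 * 2 ^ n * y ^ (T n + 1) / 2 ^ g n * C ^ T n) =
        ln 8 + real n * ln 2 + (real (T n) + 1) * ln y - real (g n) * ln 2 + real (T n) * ln C" if "y > 0" for y
      using that C(1) by (simp add: ln_mult_pos ln_div ln_realpow distrib_right)
    from this[of "real (n ^ 3 + 1)"] show ?thesis using D1[of n] by (simp add: \<epsilon>_def l\<epsilon>_def)
  qed
  have lnR: "ln (R n) = lR n" for n
  proof -
    have "(\<epsilon> n)\<^sup>2 > 0" "L n ^ (d - 2) > 0" using \<epsilon>0[of n] L1[of n] by auto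
    then show ?thesis using \<epsilon>0[of n] L1[of n]
      unfolding R_def lR_def by (simp add: ln_mult_pos ln_realpow lnL ln\<epsilon>)
  qed
  \<comment> \<open>The prefix \<open>l\<close> marks logarithms; \<open>E1\<close> bounds the Mahler measure of the factor and \<open>E2\<close> the logarithm of
    the small value.\<close>
  have T_bounds: "x n + 1 \<le> real (T n)" "real (T n) \<le> x n + 2" for n
  proof -
    have "x n \<ge> 0" unfolding x_def using m by (intro divide_nonneg_pos add_nonneg_nonneg ln_ge_zero) auto
    then have "real (nat \<lceil>x n\<rceil>) = of_int \<lceil>x n\<rceil>" by simp
    then have "real (T n) = of_int \<lceil>x n\<rceil> + 1" unfolding T_def by simp
    then show "x n + 1 \<le> real (T n)" "real (T n) \<le> x n + 2" by linarith+
  qed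
  have limx: "(\<lambda>n. (x n + c) / real n) \<longlonglongrightarrow> ln 2 / m" for c
  proof -
    have "(\<lambda>n. (real n * ln 2 + ln (real n ^ 3 + 1)) / real n) \<longlonglongrightarrow> ln 2" by real_asymp
    moreover have "(\<lambda>n. 1 / real n) \<longlonglongrightarrow> 0" by real_asymp
    ultimately have "(\<lambda>n. (real n * ln 2 + ln (real n ^ 3 + 1)) / real n / m + c * (1 / real n)) \<longlonglongrightarrow> ln 2 / m + c * 0"
      using m by (intro tendsto_intros) auto
    moreover have "(x n + c) / real n = (real n * ln 2 + ln (real n ^ 3 + 1)) / real n / m + c * (1 / real n)" for n
      unfolding x_def by (simp only: add_divide_distrib divide_divide_eq_left times_divide_eq_right mult_1_right mult.commute[of m])
    ultimately show ?thesis by simp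
  qed
  have limT: "(\<lambda>n. real (T n) / real n) \<longlonglongrightarrow> ln 2 / m"
  proof (rule tendsto_sandwich[OF _ _ limx[of 1] limx[of 2]])
    show "\<forall>\<^sub>F n in sequentially. (x n + 1) / real n \<le> real (T n) / real n"
      by (intro always_eventually allI divide_right_mono T_bounds) simp
    show "\<forall>\<^sub>F n in sequentially. real (T n) / real n \<le> (x n + 2) / real n"
      by (intro always_eventually allI divide_right_mono T_bounds) simp
  qed
  have ev0: "\<forall>\<^sub>F n in sequentially. n > (0::nat)" by (rule eventually_gt_at_top)
  have limTln: "(\<lambda>n. real (T n) * ln (real n ^ 3 + 1) / real n ^ 3) \<longlonglongrightarrow> 0"
  proof -
    have "(\<lambda>n. ln (real n ^ 3 + 1) / real n ^ 2) \<longlonglongrightarrow> 0" by real_asymp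
    from tendsto_mult[OF limT this] have "(\<lambda>n. real (T n) / real n * (ln (real n ^ 3 + 1) / real n ^ 2)) \<longlonglongrightarrow> 0" by simp
    then show ?thesis
      by (rule Lim_transform_eventually) (use ev0 in \<open>eventually_elim, simp add: power3_eq_cube power2_eq_square\<close>)
  qed
  have limT3: "(\<lambda>n. real (T n) / real n ^ 3) \<longlonglongrightarrow> 0"
  proof -
    have "(\<lambda>n. 1 / real n ^ 2) \<longlonglongrightarrow> 0" by real_asymp
    from tendsto_mult[OF limT this] have "(\<lambda>n. real (T n) / real n * (1 / real n ^ 2)) \<longlonglongrightarrow> 0" by simp
    then show ?thesis
      by (rule Lim_transform_eventually) (use ev0 in \<open>eventually_elim, simp add: power3_eq_cube power2_eq_square\<close>)
  qed
  have limg: "(\<lambda>n. real (g n) / real n ^ 3) \<longlonglongrightarrow> m / (2 * ln 2)"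
  proof -
    have inv: "(\<lambda>n. 1 / (2 * (real (T n) / real n))) \<longlonglongrightarrow> 1 / (2 * (ln 2 / m))"
      using m by (intro tendsto_intros limT) auto
    then have up: "(\<lambda>n. 1 / (2 * (real (T n) / real n))) \<longlonglongrightarrow> m / (2 * ln 2)" by simp
    have "(\<lambda>n. 1 / real n ^ 3) \<longlonglongrightarrow> 0" by real_asymp
    from tendsto_diff[OF up this]
    have down: "(\<lambda>n. 1 / (2 * (real (T n) / real n)) - 1 / real n ^ 3) \<longlonglongrightarrow> m / (2 * ln 2)" by simp
    have eq: "1 / (2 * (real (T n) / real n)) = real (n * n ^ 3) / real (2 * T n) / real n ^ 3" if "n > 0" for n
      using that by (simp add: field_simps)
    have lo: "\<forall>\<^sub>F n in sequentially. 1 / (2 * (real (T n) / real n)) - 1 / real n ^ 3 \<le> real (g n) / real n ^ 3"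
      using ev0
    proof eventually_elim
      case (elim n)
      have "2 * T n > 0" by (simp add: T_def)
      then have "real (n * n ^ 3) / real (2 * T n) - 1 \<le> real (g n)"
      proof -
        have "n * n ^ 3 < 2 * T n * (g n + 1)"
          using dividend_less_times_div[OF \<open>2 * T n > 0\<close>, of "n * n ^ 3"] by (simp add: g_def)
        then have "real (n * n ^ 3) < real (2 * T n * (g n + 1))" by (simp only: of_nat_less_iff)
        then have *: "real (n * n ^ 3) < (real (g n) + 1) * real (2 * T n)" by (simp add: algebra_simps)
        then have "real (n * n ^ 3) / real (2 * T n) < real (g n) + 1"
        proof -
          have "real (2 * T n) > 0" using \<open>2 * T n > 0\<close> by (simp only: of_nat_0_less_iff)
          then show ?thesis using * by (simp only: pos_divide_less_eq)
        qed
        then show ?thesis by simp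
      qed
      then have "(real (n * n ^ 3) / real (2 * T n) - 1) / real n ^ 3 \<le> real (g n) / real n ^ 3"
        by (intro divide_right_mono) auto
      then show ?case unfolding eq[OF elim] by (simp add: diff_divide_distrib)
    qed
    have hi: "\<forall>\<^sub>F n in sequentially. real (g n) / real n ^ 3 \<le> 1 / (2 * (real (T n) / real n))"
      using ev0
    proof eventually_elim
      case (elim n)
      have pos: "real (2 * T n) > 0" by (simp add: T_def)
      have "2 * T n * g n \<le> n * n ^ 3" unfolding g_def by (rule times_div_less_eq_dividend)
      then have "real (2 * T n * g n) \<le> real (n * n ^ 3)" by (simp only: of_nat_le_iff)
      then have "real (g n) * real (2 * T n) \<le> real (n * n ^ 3)" by (simp add: mult_ac)
      then have "real (g n) \<le> real (n * n ^ 3) / real (2 * T n)" using pos by (simp only: pos_le_divide_eq)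
      then have "real (g n) / real n ^ 3 \<le> real (n * n ^ 3) / real (2 * T n) / real n ^ 3"
        by (intro divide_right_mono) auto
      then show ?case unfolding eq[OF elim] .
    qed
    show ?thesis by (rule tendsto_sandwich[OF lo hi down up])
  qed
  have lim_ln: "(\<lambda>n. ln (real n ^ 3 + 1) / real n ^ 3) \<longlonglongrightarrow> 0" by real_asymp
  have lim_n: "(\<lambda>n. real n * ln 2 / real n ^ 3) \<longlonglongrightarrow> 0" by real_asymp
  have lim_c: "(\<lambda>n. c / real n ^ 3) \<longlonglongrightarrow> 0" for c :: real
  proof -
    have "(\<lambda>n. 1 / real n ^ 3) \<longlonglongrightarrow> 0" by real_asymp
    from tendsto_mult[OF tendsto_const[of c] this] show ?thesis by simp
  qed
  have limL: "(\<lambda>n. lL n / real n ^ 3) \<longlonglongrightarrow> 0"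
  proof -
    have "(\<lambda>n. real d * (real (T n) * ln (real n ^ 3 + 1) / real n ^ 3) + (ln (real n ^ 3 + 1) / real n ^ 3 + real n * ln 2 / real n ^ 3)) \<longlonglongrightarrow> real d * 0 + (0 + 0)"
      by (intro tendsto_intros limTln lim_ln lim_n)
    then show ?thesis by (simp add: lL_def add_divide_distrib mult.assoc)
  qed
  have lim\<epsilon>: "(\<lambda>n. l\<epsilon> n / real n ^ 3) \<longlonglongrightarrow> - m / 2"
  proof -
    have "(\<lambda>n. ln 8 / real n ^ 3 + real n * ln 2 / real n ^ 3 + (real (T n) * ln (real n ^ 3 + 1) / real n ^ 3 + ln (real n ^ 3 + 1) / real n ^ 3)
       - real (g n) / real n ^ 3 * ln 2 + real (T n) / real n ^ 3 * ln C) \<longlonglongrightarrow> 0 + 0 + (0 + 0) - m / (2 * ln 2) * ln 2 + 0 * ln C"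
      by (intro tendsto_intros limTln lim_ln lim_n limg limT3 lim_c)
    moreover have "0 + 0 + (0 + 0) - m / (2 * ln 2) * ln 2 + 0 * ln C = - m / 2" by simp
    ultimately show ?thesis
      by (simp add: l\<epsilon>_def add_divide_distrib diff_divide_distrib distrib_right)
  qed
  have limR: "(\<lambda>n. lR n / real n ^ 3) \<longlonglongrightarrow> 0"
  proof -
    have "(\<lambda>n. 2 * (l\<epsilon> n / real n ^ 3) + real (d - 2) * (lL n / real n ^ 3) + m) \<longlonglongrightarrow> 2 * (- m / 2) + real (d - 2) * 0 + m"
      by (intro tendsto_intros limL lim\<epsilon>)
    then have "(\<lambda>n. 2 * (l\<epsilon> n / real n ^ 3) + real (d - 2) * (lL n / real n ^ 3) + m) \<longlonglongrightarrow> 0" by simp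
    then show ?thesis
      by (rule Lim_transform_eventually) (use ev0 in \<open>eventually_elim, simp add: lR_def add_divide_distrib\<close>)
  qed
  have limE1: "(\<lambda>n. E1 n / real n ^ 3) \<longlonglongrightarrow> 0"
  proof -
    have "(\<lambda>n. ln (len * (real n ^ 3 + real d) + 1) / real n ^ 3) \<longlonglongrightarrow> 0"
    proof (cases "len = 0")
      case False
      then have "len > 0" using len0 by simp
      then show ?thesis by real_asymp
    qed simp
    then have "(\<lambda>n. ln (2 * a) / real n ^ 3 + lR n / real n ^ 3 + (ln (len * (real n ^ 3 + real d) + 1) / real n ^ 3 + lL n / real n ^ 3)) \<longlonglongrightarrow> 0 + 0 + (0 + 0)"
      by (intro tendsto_intros limR limL lim_c)
    then show ?thesis by (simp add: E1_def add_divide_distrib)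
  qed
  have limE2: "(\<lambda>n. E2 n / (real n ^ 3 + real d)) \<longlonglongrightarrow> - m / 2"
  proof -
    have "(\<lambda>n. real n ^ 3 / (real n ^ 3 + real d)) \<longlonglongrightarrow> 1" by real_asymp
    then have "(\<lambda>n. (ln (2 * a) / real n ^ 3 + lR n / real n ^ 3 + l\<epsilon> n / real n ^ 3) * (real n ^ 3 / (real n ^ 3 + real d))) \<longlonglongrightarrow> (0 + 0 + - m / 2) * 1"
      by (intro tendsto_intros limR lim\<epsilon> lim_c)
    then have "(\<lambda>n. (ln (2 * a) / real n ^ 3 + lR n / real n ^ 3 + l\<epsilon> n / real n ^ 3) * (real n ^ 3 / (real n ^ 3 + real d))) \<longlonglongrightarrow> - m / 2" by simp
    then show ?thesis
    proof (rule Lim_transform_eventually)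
      show "\<forall>\<^sub>F n in sequentially. (ln (2 * a) / real n ^ 3 + lR n / real n ^ 3 + l\<epsilon> n / real n ^ 3) * (real n ^ 3 / (real n ^ 3 + real d)) = E2 n / (real n ^ 3 + real d)"
        using ev0 by eventually_elim (simp add: E2_def flip: add_divide_distrib)
    qed
  qed
  \<comment> \<open>A bound on \<open>E2 n / (n^3 + d)\<close> passes to \<open>E2 n / (K d)\<close> only if \<open>E2 n\<close> is negative, hence the minimum
    with \<open>0\<close>.\<close>
  have e': "e / real d > 0" using e d2 by simp
  have "\<forall>\<^sub>F n in sequentially. real (g n) / real n ^ 3 > 0"
    using m by (intro order_tendstoD(1)[OF limg]) simp
  moreover have "\<forall>\<^sub>F n in sequentially. E1 n / real n ^ 3 < e / real d"
    by (rule order_tendstoD(2)[OF limE1 e'])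
  moreover have "\<forall>\<^sub>F n in sequentially. E2 n / (real n ^ 3 + real d) < min 0 (e - m / 2)"
    using m e by (intro order_tendstoD(2)[OF limE2]) simp
  moreover have "\<forall>\<^sub>F n in sequentially. n \<ge> N * d + 1" by (rule eventually_ge_at_top)
  ultimately have "\<forall>\<^sub>F n in sequentially. real (g n) / real n ^ 3 > 0 \<and> E1 n / real n ^ 3 < e / real d \<and>
      E2 n / (real n ^ 3 + real d) < min 0 (e - m / 2) \<and> n \<ge> N * d + 1" by eventually_elim simp
  then obtain n where n: "real (g n) / real n ^ 3 > 0" "E1 n / real n ^ 3 < e / real d"
      "E2 n / (real n ^ 3 + real d) < min 0 (e - m / 2)" "n \<ge> N * d + 1"
    using eventually_happens[of _ sequentially] by (metis (no_types, lifting) trivial_limit_sequentially)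
  have n1: "n \<ge> 1" using n(4) by simp
  have n3: "real n ^ 3 > 0" using n1 by simp
  have g1: "g n \<ge> 1" using n(1) by (cases "g n") auto
  have gT: "2 * T n * g n \<le> n * n ^ 3" unfolding g_def by (rule times_div_less_eq_dividend)
  have Tm: "real n * ln 2 + ln (real (n ^ 3 + 1)) < real (T n) * log_mahler f"
  proof -
    have "real n * ln 2 + ln (real (n ^ 3 + 1)) = x n * m" using m by (simp add: x_def add.commute)
    also have "\<dots> < real (T n) * m" using T_bounds(1)[of n] m by (intro mult_strict_right_mono) auto
    finally show ?thesis by (simp add: m_def)
  qed
  obtain Q where Q: "poly (cpoly Q) \<kappa> \<noteq> 0" "degree Q \<le> n ^ 3" "poly_length (cpoly Q) \<le> L n" "cmod (poly (cpoly Q) \<kappa>) \<le> \<epsilon> n"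
    using exists_small_value[OF f(1,2) k(1) n1 g1 gT Tm C] unfolding L_def \<epsilon>_def d_def by blast
  define b where "b = of_int (lead_coeff f) * R n + 1"
  have Rn: "R n = (\<epsilon> n)\<^sup>2 * L n ^ (d - 2) * exp (real (n ^ 3) * log_mahler f)" by (simp add: R_def m_def)
  obtain A where A: "irreducible A" "lead_coeff A \<ge> 1" "poly (cpoly A) \<kappa> \<noteq> 0" "K n \<le> degree A" "R n \<ge> 1"
    "log_mahler A \<le> ln (b * (len * (K n * d) + L n))"
    "ln (cmod (poly (cpoly A) \<kappa>)) - ln (of_int (lead_coeff A)) \<le> ln (b * \<epsilon> n) / (K n * d) * degree A"
    using exists_irreducible_small_value[OF f k Q d_def _ Rn b_def, of "K n"] unfolding K_def len_def by blast
  have b: "0 < b" "b \<le> 2 * a * R n"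
  proof -
    have "a * R n \<ge> 1" using a1 A(5) mult_mono[of 1 a 1 "R n"] by simp
    then show "0 < b" "b \<le> 2 * a * R n" unfolding b_def a_def[symmetric] by linarith+
  qed
  have lnb: "ln b \<le> ln (2 * a) + lR n"
  proof -
    have "ln b \<le> ln (2 * a * R n)" using b by (intro ln_mono)
    also have "\<dots> = ln (2 * a) + lR n" using a1 R0[of n] by (simp add: ln_mult lnR)
    finally show ?thesis .
  qed
  have KdD: "n ^ 3 < K n * d" "K n * d \<le> n ^ 3 + d"
    unfolding K_def using d2 dividend_less_div_times[of d "n ^ 3"] div_times_less_eq_dividend[of "n ^ 3" d]
    by (simp_all add: add_mult_distrib)
  have KdR: "real n ^ 3 < real (K n * d)" "real (K n * d) \<le> real n ^ 3 + real d"
  proof -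
    have "real (n ^ 3) < real (K n * d)" using KdD(1) by (simp only: of_nat_less_iff)
    then show "real n ^ 3 < real (K n * d)" by simp
    have "real (K n * d) \<le> real (n ^ 3 + d)" using KdD(2) by (simp only: of_nat_le_iff)
    then show "real (K n * d) \<le> real n ^ 3 + real d" by simp
  qed
  have "N \<le> degree A"
  proof -
    have "N * d < n" using n(4) by simp
    also have "n \<le> n ^ 3" using n1 by (simp add: self_le_power)
    also have "n ^ 3 < K n * d" by (rule KdD)
    finally have "N < K n" by simp
    then show ?thesis using A(4) by simp
  qed
  moreover have "log_mahler A \<le> e * degree A"
  proof -
    have "ln (b * (len * (K n * d) + L n)) = ln b + ln (len * (K n * d) + L n)"
      using b(1) L1[of n] len0 by (intro ln_mult_pos) (auto intro!: add_nonneg_pos)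
    also have "ln (len * (K n * d) + L n) \<le> ln ((len * (real n ^ 3 + real d) + 1) * L n)"
    proof (rule ln_mono)
      have "len * real (K n * d) \<le> len * (real n ^ 3 + real d)" using KdR(2) len0 by (intro mult_left_mono)
      also have "\<dots> = len * (real n ^ 3 + real d) * 1" by simp
      also have "\<dots> \<le> len * (real n ^ 3 + real d) * L n" using L1[of n] len0 by (intro mult_left_mono) auto
      finally show "len * real (K n * d) + L n \<le> (len * (real n ^ 3 + real d) + 1) * L n" by (simp add: distrib_right)
      show "0 < len * real (K n * d) + L n" using L1[of n] len0 by (auto intro!: add_nonneg_pos)
    qed
    also have "\<dots> = ln (len * (real n ^ 3 + real d) + 1) + lL n"
      using L1[of n] len0 by (subst ln_mult_pos) (auto simp: lnL intro!: add_nonneg_pos)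
    finally have "log_mahler A \<le> E1 n" using A(6) lnb unfolding E1_def by simp
    also have "\<dots> \<le> e / real d * real n ^ 3" using n(2) n3 by (simp add: divide_less_eq)
    also have "\<dots> \<le> e / real d * real (K n * d)" using KdR(1) e' by (intro mult_left_mono) auto
    also have "\<dots> = e * real (K n)" using d2 by simp
    also have "\<dots> \<le> e * degree A" using A(4) e by simp
    finally show ?thesis .
  qed
  moreover have "ln (cmod (poly (cpoly A) \<kappa>)) - ln (of_int (lead_coeff A)) \<le> (e - log_mahler f / 2) * degree A"
  proof -
    have dpos: "real n ^ 3 + real d > 0" using n3 by (intro add_pos_nonneg) auto
    have "E2 n / (real n ^ 3 + real d) < 0" using n(3) by simp
    then have E2neg: "E2 n < 0" using dpos by (simp add: divide_less_0_iff)
    have "ln (b * \<epsilon> n) = ln b + ln (\<epsilon> n)" using b(1) \<epsilon>0[of n] by (intro ln_mult_pos) auto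
    also have "\<dots> \<le> E2 n" unfolding E2_def ln\<epsilon> using lnb by simp
    finally have "ln (b * \<epsilon> n) / (K n * d) \<le> E2 n / (K n * d)" by (intro divide_right_mono) auto
    also have "\<dots> \<le> E2 n / (real n ^ 3 + real d)"
    proof (rule divide_left_mono_neg)
      have "0 < real (K n * d)" using n3 KdR(1) by linarith
      then show "0 < real (K n * d) * (real n ^ 3 + real d)" using dpos by (rule mult_pos_pos)
    qed (use E2neg KdR(2) in auto)
    also have "\<dots> \<le> e - m / 2" using n(3) by simp
    finally have "ln (b * \<epsilon> n) / (K n * d) * degree A \<le> (e - m / 2) * degree A" by (intro mult_right_mono) auto
    then show ?thesis using A(7) by (simp add: m_def)
  qed
  ultimately show ?thesis using A(1-3) by blast
qed

text \<open>Applying the construction with tolerance \<open>1/(n+1)\<close> and degree greater than \<open>n\<close> gives a strict sequence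
  that satisfies the upper bound; the lower bound is Liouville's inequality.\<close>

theorem theorem3:
  fixes \<kappa> :: complex and d :: nat
  assumes "algebraic \<kappa>" and "\<kappa> \<notin> roots_of_unity" and "cmod \<kappa> = 1"
    and "d = rat_degree \<kappa>"
  shows "\<exists>\<alpha> :: nat \<Rightarrow> complex.
    (\<forall>n. algebraic (\<alpha> n)) \<and> strict_sequence \<alpha> \<and>
    (\<forall>n. \<not> conjugate (\<alpha> n) \<kappa>) \<and>
    (\<lambda>n. weil_height (\<alpha> n)) \<longlonglongrightarrow> 0 \<and>
    limsup (\<lambda>n. ereal (mean_log_dist \<kappa> (\<alpha> n))) \<le> ereal (- weil_height \<kappa>) \<and>
    - weil_height \<kappa> < 0 \<and>
    liminf (\<lambda>n. ereal (mean_log_dist \<kappa> (\<alpha> n))) \<ge> ereal (- (real d * (weil_height \<kappa> + ln 2)))"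
proof -
  define f where "f = int_min_poly \<kappa>"
  note f = int_min_poly_props[OF assms(1), folded f_def]
  have d: "d = degree f" unfolding assms(4) f_def by (rule rat_degree_eq[OF assms(1)])
  have d2: "d \<ge> 2" using unit_circle_root_cnj(2)[OF f(1,2) assms(3,2)] d by simp
  define m where "m = log_mahler f"
  have m: "m > 0" unfolding m_def by (rule log_mahler_pos[OF f(1,2) assms(3,2)])
  have h: "weil_height \<kappa> = m / real d" unfolding m_def d by (rule weil_height_eq[OF f])
  define e where "e = (\<lambda>n::nat. 1 / (real n + 1))"
  have e: "e n > 0" for n by (simp add: e_def)
  have elim: "e \<longlonglongrightarrow> 0" unfolding e_def by real_asymp
  have "\<exists>A. irreducible A \<and> lead_coeff A \<ge> 1 \<and> poly (cpoly A) \<kappa> \<noteq> 0 \<and> n + 1 \<le> degree A \<and>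
    log_mahler A \<le> e n * degree A \<and>
    ln (cmod (poly (cpoly A) \<kappa>)) - ln (of_int (lead_coeff A)) \<le> (e n - m / 2) * degree A" for n
    unfolding m_def using exists_irreducible_small_height_and_value[OF f assms(3,2) e, of "n + 1" n] .
  then obtain A where A: "\<And>n. irreducible (A n)" "\<And>n. lead_coeff (A n) \<ge> 1" "\<And>n. poly (cpoly (A n)) \<kappa> \<noteq> 0"
      "\<And>n. n + 1 \<le> degree (A n)" "\<And>n. log_mahler (A n) \<le> e n * degree (A n)"
      "\<And>n. ln (cmod (poly (cpoly (A n)) \<kappa>)) - ln (of_int (lead_coeff (A n))) \<le> (e n - m / 2) * degree (A n)"
    by metis
  have dA: "degree (A n) > 0" for n using A(4)[of n] by simp
  have A0: "A n \<noteq> 0" for n using A(1)[of n] by auto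
  have "\<exists>z. poly (cpoly (A n)) z = 0" for n
    using dA[of n] by (intro fundamental_theorem_of_algebra_alt notI) (auto dest!: arg_cong[of _ _ degree])
  then obtain \<alpha> where \<alpha>: "\<And>n. poly (cpoly (A n)) (\<alpha> n) = 0" by metis
  have alg: "algebraic (\<alpha> n)" for n using \<alpha>[of n] A0[of n] by (intro algebraicI[of "cpoly (A n)"]) auto
  have min: "int_min_poly (\<alpha> n) = A n" for n by (rule int_min_poly_eqI[OF A(1) \<alpha> A(2)])
  have ht: "weil_height (\<alpha> n) = log_mahler (A n) / degree (A n)" for n by (rule weil_height_eq[OF A(1) \<alpha> A(2)])
  have mean: "mean_log_dist \<kappa> (\<alpha> n) = (ln (cmod (poly (cpoly (A n)) \<kappa>)) - ln (of_int (lead_coeff (A n)))) / degree (A n)" for n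
    by (rule mean_log_dist_eq[OF A(1) \<alpha> A(2) A(3)])
  have "strict_sequence \<alpha>"
    unfolding strict_sequence_def
  proof (intro allI impI)
    fix \<beta> :: complex
    have "{n. \<alpha> n = \<beta>} \<subseteq> {..degree (int_min_poly \<beta>)}"
      using A(4) min by (auto dest: Suc_leD) (metis Suc_eq_plus1 Suc_leD)
    then show "finite {n. \<alpha> n = \<beta>}" by (rule finite_subset) simp
  qed
  moreover have "\<not> conjugate (\<alpha> n) \<kappa>" for n by (rule not_conjugate_if_not_common_root[OF alg assms(1) \<alpha> A(3)])
  moreover have hlim: "(\<lambda>n. weil_height (\<alpha> n)) \<longlonglongrightarrow> 0"
  proof (rule tendsto_sandwich)
    show "\<forall>\<^sub>F n in sequentially. 0 \<le> weil_height (\<alpha> n)" by (simp add: ht log_mahler_nonneg A0)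
    show "\<forall>\<^sub>F n in sequentially. weil_height (\<alpha> n) \<le> e n"
      using A(5) dA by (intro always_eventually allI) (simp add: ht divide_le_eq)
  qed (use elim in auto)
  moreover have "limsup (\<lambda>n. ereal (mean_log_dist \<kappa> (\<alpha> n))) \<le> ereal (- weil_height \<kappa>)"
  proof -
    have hm: "weil_height \<kappa> \<le> m / 2" unfolding h using m d2 by (intro divide_left_mono) auto
    have "mean_log_dist \<kappa> (\<alpha> n) \<le> e n - weil_height \<kappa>" for n
    proof -
      have "mean_log_dist \<kappa> (\<alpha> n) \<le> e n - m / 2" unfolding mean using A(6)[of n] dA[of n] by (simp add: divide_le_eq)
      then show ?thesis using hm by simp
    qed
    then have "limsup (\<lambda>n. ereal (mean_log_dist \<kappa> (\<alpha> n))) \<le> limsup (\<lambda>n. ereal (e n - weil_height \<kappa>))"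
      by (intro Limsup_mono always_eventually allI) simp
    also have "(\<lambda>n. ereal (e n - weil_height \<kappa>)) \<longlonglongrightarrow> ereal (0 - weil_height \<kappa>)"
      by (intro tendsto_intros elim)
    then have "limsup (\<lambda>n. ereal (e n - weil_height \<kappa>)) = ereal (0 - weil_height \<kappa>)"
      by (intro lim_imp_Limsup) auto
    finally show ?thesis by simp
  qed
  moreover have "- weil_height \<kappa> < 0" unfolding h using m d2 by simp
  moreover have "ereal (- (real d * (weil_height \<kappa> + ln 2))) \<le> liminf (\<lambda>n. ereal (mean_log_dist \<kappa> (\<alpha> n)))"
  proof -
    define l where "l = (\<lambda>n. - (m + real (d - 1) * (ln 2 + weil_height (\<alpha> n))) - weil_height (\<alpha> n))"
    have "l n \<le> mean_log_dist \<kappa> (\<alpha> n)" for n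
    proof -
      have "ln (of_int (lead_coeff (A n))) \<le> log_mahler (A n)"
        using log_mahler_ge_lead_coeff[OF A0[of n]] A(2)[of n] by simp
      then have "ln (of_int (lead_coeff (A n))) / degree (A n) \<le> weil_height (\<alpha> n)"
        unfolding ht by (intro divide_right_mono) auto
      moreover have "- (m + real (d - 1) * (ln 2 + weil_height (\<alpha> n))) \<le> ln (cmod (poly (cpoly (A n)) \<kappa>)) / degree (A n)"
        unfolding ht m_def d by (rule mean_log_dist_lower[OF f(1,2) A0 dA A(3)])
      ultimately show ?thesis unfolding mean l_def diff_divide_distrib by linarith
    qed
    then have "liminf (\<lambda>n. ereal (l n)) \<le> liminf (\<lambda>n. ereal (mean_log_dist \<kappa> (\<alpha> n)))"
      by (intro Liminf_mono always_eventually allI) simp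
    moreover have "(\<lambda>n. ereal (l n)) \<longlonglongrightarrow> ereal (- (m + real (d - 1) * (ln 2 + 0)) - 0)"
      unfolding l_def by (intro tendsto_intros hlim)
    then have "liminf (\<lambda>n. ereal (l n)) = ereal (- (m + real (d - 1) * (ln 2 + 0)) - 0)"
      by (intro lim_imp_Liminf) auto
    moreover have "- (real d * (weil_height \<kappa> + ln 2)) \<le> - (m + real (d - 1) * (ln 2 + 0)) - 0"
    proof -
      have "real d * (weil_height \<kappa> + ln 2) = m + real d * ln 2" unfolding h using d2 by (simp add: distrib_left)
      moreover have "real (d - 1) * ln 2 \<le> real d * ln 2" by (intro mult_right_mono) auto
      ultimately show ?thesis by simp
    qed
    then have "ereal (- (real d * (weil_height \<kappa> + ln 2))) \<le> ereal (- (m + real (d - 1) * (ln 2 + 0)) - 0)"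
      by (simp only: ereal_less_eq)
    ultimately show ?thesis by (metis order_trans)
  qed
  ultimately show ?thesis using alg by (intro exI[of _ \<alpha>]) simp
qed

end
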